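(* For every domain $X$, the following conditions are equivalent: (i) $X$ is an RB-domain; (ii) the function space $[X\to E]$ is continuous for every domain $E$. Moreover, the algebraic domain $A_X=E_X\times V$ (defined in the context) has the property that if $[X\to A_X]$ is continuous, then $X$ is an RB-domain.
   Context: A domain is a nonempty continuous dcpo; directed subsets are nonempty. Domains are not assumed to have a least element. For dcpos $X,Y$, $[X\to Y]$ is the dcpo of Scott-continuous maps $X\to Y$ ordered pointwise (directed suprema are computed pointwise). A dcpo is algebraic if every element is the directed supremum of the compact elements below it ($k$ is compact if $k\ll k$). A deflation on a domain $X$ is a Scott-continuous map $d:X\to X$ with finite image and $d\le \mathrm{id}_X$ (no idempotence is required). $X$ is an RB-domain if there is a directed family of deflations in $[X\to X]$ whose supremum is $\mathrm{id}_X$. Construction of $A_X$: let $\mathcal D(X)=\{\varnothing\}\cup\{A\subseteq X: A \text{ is a directed subset of } X\}$, let $\mathcal P(X)$ be the powerset of $X$, and let $E_X=(\mathcal D(X)\times\{0\})\cup(\mathcal P(X)\times\{1\})$, ordered by $(A,i)\le(B,j)\iff A\subseteq B$ and $i\le j$. Let $V=\{\ell,r,\top\}$ be the three-element poset with $\ell<\top$, $r<\top$ and $\ell,r$ incomparable. Then $A_X=E_X\times V$ with the componentwise order. *)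

theory Defs
  imports "HOL-Algebra.Order" "HOL-Library.FuncSet"
begin

section \<open>Domains\<close>

text \<open>Posets are the carrier-based orders of \<^theory>\<open>HOL-Algebra.Order\<close> (locale
  \<^locale>\<open>partial_order\<close>, whose \<open>eq\<close> field is genuine equality), so that one can quantify
  over them inside a formula. Values of the order outside the carrier are irrelevant.\<close>

definition directed_in :: "'a gorder \<Rightarrow> 'a set \<Rightarrow> bool" where
  "directed_in L D \<longleftrightarrow> D \<subseteq> carrier L \<and> D \<noteq> {} \<and>
     (\<forall>x\<in>D. \<forall>y\<in>D. \<exists>z\<in>D. x \<sqsubseteq>\<^bsub>L\<^esub> z \<and> y \<sqsubseteq>\<^bsub>L\<^esub> z)"

definition dcpo :: "'a gorder \<Rightarrow> bool" where
  "dcpo L \<longleftrightarrow> partial_order L \<and> (\<forall>D. directed_in L D \<longrightarrow> (\<exists>s. is_lub L s D))"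

definition way_below :: "'a gorder \<Rightarrow> 'a \<Rightarrow> 'a \<Rightarrow> bool" where
  "way_below L x y \<longleftrightarrow> x \<in> carrier L \<and> y \<in> carrier L \<and>
     (\<forall>D s. directed_in L D \<longrightarrow> is_lub L s D \<longrightarrow> y \<sqsubseteq>\<^bsub>L\<^esub> s \<longrightarrow> (\<exists>d\<in>D. x \<sqsubseteq>\<^bsub>L\<^esub> d))"

definition compact_in :: "'a gorder \<Rightarrow> 'a \<Rightarrow> bool" where
  "compact_in L k \<longleftrightarrow> way_below L k k"

definition continuous_dcpo :: "'a gorder \<Rightarrow> bool" where
  "continuous_dcpo L \<longleftrightarrow> dcpo L \<and>
     (\<forall>x\<in>carrier L. directed_in L {y. way_below L y x} \<and> is_lub L x {y. way_below L y x})"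

definition algebraic_dcpo :: "'a gorder \<Rightarrow> bool" where
  "algebraic_dcpo L \<longleftrightarrow> dcpo L \<and>
     (\<forall>x\<in>carrier L. directed_in L {k. compact_in L k \<and> k \<sqsubseteq>\<^bsub>L\<^esub> x} \<and>
                     is_lub L x {k. compact_in L k \<and> k \<sqsubseteq>\<^bsub>L\<^esub> x})"

definition cont_domain :: "'a gorder \<Rightarrow> bool" where
  "cont_domain L \<longleftrightarrow> continuous_dcpo L \<and> carrier L \<noteq> {}"


section \<open>Function spaces and RB-domains\<close>

definition scott_continuous :: "'a gorder \<Rightarrow> 'b gorder \<Rightarrow> ('a \<Rightarrow> 'b) \<Rightarrow> bool" where
  "scott_continuous X Y f \<longleftrightarrow> f \<in> carrier X \<rightarrow> carrier Y \<and> isotone X Y f \<and>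
     (\<forall>D s. directed_in X D \<longrightarrow> is_lub X s D \<longrightarrow> is_lub Y (f s) (f ` D))"

text \<open>Maps are taken extensional, i.e. equal to \<^const>\<open>undefined\<close> outside the carrier of
  \<open>X\<close>, so that elements of \<open>[X \<rightarrow> Y]\<close> correspond exactly to maps on the carrier.\<close>

definition fun_space :: "'a gorder \<Rightarrow> 'b gorder \<Rightarrow> ('a \<Rightarrow> 'b) gorder" where
  "fun_space X Y =
     \<lparr> carrier = {f \<in> carrier X \<rightarrow>\<^sub>E carrier Y. scott_continuous X Y f},
       eq = (=),
       le = (\<lambda>f g. \<forall>x\<in>carrier X. f x \<sqsubseteq>\<^bsub>Y\<^esub> g x) \<rparr>"

definition deflation :: "'a gorder \<Rightarrow> ('a \<Rightarrow> 'a) \<Rightarrow> bool" where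
  "deflation X d \<longleftrightarrow> d \<in> carrier (fun_space X X) \<and> finite (d ` carrier X) \<and>
     (\<forall>x\<in>carrier X. d x \<sqsubseteq>\<^bsub>X\<^esub> x)"

definition RB_domain :: "'a gorder \<Rightarrow> bool" where
  "RB_domain X \<longleftrightarrow> cont_domain X \<and>
     (\<exists>\<D>. directed_in (fun_space X X) \<D> \<and> (\<forall>d\<in>\<D>. deflation X d) \<and>
          is_lub (fun_space X X) (restrict id (carrier X)) \<D>)"


section \<open>The test domain\<close>

definition prod_order :: "'a gorder \<Rightarrow> 'b gorder \<Rightarrow> ('a \<times> 'b) gorder" where
  "prod_order L M =
     \<lparr> carrier = carrier L \<times> carrier M,
       eq = (=),
       le = (\<lambda>(a, b) (c, d). a \<sqsubseteq>\<^bsub>L\<^esub> c \<and> b \<sqsubseteq>\<^bsub>M\<^esub> d) \<rparr>"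

definition E_order :: "'a gorder \<Rightarrow> ('a set \<times> nat) gorder" where
  "E_order X =
     \<lparr> carrier = ({{}} \<union> {A. directed_in X A}) \<times> {0} \<union> Pow (carrier X) \<times> {1},
       eq = (=),
       le = (\<lambda>(A, i) (B, j). A \<subseteq> B \<and> i \<le> j) \<rparr>"

datatype vee = VLeft | VRight | VTop

definition V_order :: "vee gorder" where
  "V_order = \<lparr> carrier = UNIV, eq = (=), le = (\<lambda>v w. v = w \<or> w = VTop) \<rparr>"

definition A_order :: "'a gorder \<Rightarrow> (('a set \<times> nat) \<times> vee) gorder" where
  "A_order X = prod_order (E_order X) V_order"

end

theory Submission
  imports Defs
begin

text \<open>
  If the deflations \<open>d\<close> approximate the identity of \<open>X\<close>, then \<open>f : X \<rightarrow> E\<close> is the directed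
  supremum of the maps \<open>g \<circ> d\<close>, where \<open>g\<close> is monotone on the finite image of \<open>d\<close> and pointwise way
  below \<open>f\<close> there; finiteness of the image makes every \<open>g \<circ> d\<close> way below \<open>f\<close>.

  Conversely, consider \<open>f x = ((\<Down>x, 0), \<top>)\<close>, where \<open>\<Down>x\<close> is the set of elements way below \<open>x\<close>, and
  let \<open>h\<close> be way below \<open>f\<close>, with first component \<open>G x \<subseteq> \<Down>x\<close>. The constant map \<open>((X, 1), \<top>)\<close> lies
  above \<open>f\<close> and is the directed supremum of the constants \<open>((S, 1), \<top>)\<close> with \<open>S\<close> finite, so all
  \<open>G x\<close> lie in one finite set. A nonempty finite directed set has a maximum, and \<open>x \<mapsto> max (G x)\<close> is
  the desired deflation, provided that no \<open>G x\<close> is empty. The factor \<open>V\<close> takes care of this: the sets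
  \<open>U\<^sub>k = {x. G\<^sub>k x \<noteq> \<emptyset>}\<close> for \<open>k\<close> way below \<open>f\<close> form a directed open cover of \<open>X\<close>. The top constant
  is also the directed supremum of the maps that take the value \<open>\<top>\<close> on \<open>U\<^sub>k\<close> and \<open>\<ell>\<close> elsewhere, so
  outside some \<open>U\<^sub>k\<close> the \<open>V\<close>-component of \<open>h\<close> is \<open>\<ell>\<close>; likewise it is \<open>r\<close> outside some \<open>U\<^sub>l\<close>. Hence
  a single \<open>U\<^sub>m\<close> is all of \<open>X\<close>.
\<close>

section \<open>Order-theoretic preliminaries\<close>

lemma partial_orderI:
  assumes "eq L = (=)"
    and "\<And>x. x \<in> carrier L \<Longrightarrow> x \<sqsubseteq>\<^bsub>L\<^esub> x"
    and "\<And>x y. \<lbrakk>x \<sqsubseteq>\<^bsub>L\<^esub> y; y \<sqsubseteq>\<^bsub>L\<^esub> x; x \<in> carrier L; y \<in> carrier L\<rbrakk> \<Longrightarrow> x = y"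
    and "\<And>x y z. \<lbrakk>x \<sqsubseteq>\<^bsub>L\<^esub> y; y \<sqsubseteq>\<^bsub>L\<^esub> z; x \<in> carrier L; y \<in> carrier L; z \<in> carrier L\<rbrakk> \<Longrightarrow> x \<sqsubseteq>\<^bsub>L\<^esub> z"
  shows "partial_order L"
  by unfold_locales (use assms in \<open>auto intro: assms(4)\<close>)

lemmas po_refl = weak_partial_order.le_refl[OF partial_order.axioms(1)]
lemmas po_trans = weak_partial_order.le_trans[OF partial_order.axioms(1)]
lemmas po_antisym = partial_order.le_antisym

lemma is_lub_iff:
  assumes "D \<subseteq> carrier L"
  shows "is_lub L s D \<longleftrightarrow> s \<in> carrier L \<and> (\<forall>x\<in>D. x \<sqsubseteq>\<^bsub>L\<^esub> s) \<and>
    (\<forall>u\<in>carrier L. (\<forall>x\<in>D. x \<sqsubseteq>\<^bsub>L\<^esub> u) \<longrightarrow> s \<sqsubseteq>\<^bsub>L\<^esub> u)"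
  using assms unfolding least_def Upper_def by blast

lemma is_lubI:
  assumes "D \<subseteq> carrier L" "s \<in> carrier L" "\<And>x. x \<in> D \<Longrightarrow> x \<sqsubseteq>\<^bsub>L\<^esub> s"
    and "\<And>u. \<lbrakk>u \<in> carrier L; \<And>x. x \<in> D \<Longrightarrow> x \<sqsubseteq>\<^bsub>L\<^esub> u\<rbrakk> \<Longrightarrow> s \<sqsubseteq>\<^bsub>L\<^esub> u"
  shows "is_lub L s D"
  using assms by (subst is_lub_iff) auto

lemma is_lub_carrier: "is_lub L s D \<Longrightarrow> s \<in> carrier L"
  unfolding least_def by blast

lemma is_lub_upper: "\<lbrakk>is_lub L s D; D \<subseteq> carrier L; x \<in> D\<rbrakk> \<Longrightarrow> x \<sqsubseteq>\<^bsub>L\<^esub> s"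
  by (simp add: is_lub_iff)

lemma is_lub_least:
  "\<lbrakk>is_lub L s D; D \<subseteq> carrier L; u \<in> carrier L; \<And>x. x \<in> D \<Longrightarrow> x \<sqsubseteq>\<^bsub>L\<^esub> u\<rbrakk> \<Longrightarrow> s \<sqsubseteq>\<^bsub>L\<^esub> u"
  by (simp add: is_lub_iff)

lemma is_lub_same: "\<lbrakk>partial_order L; is_lub L s D; is_lub L t D\<rbrakk> \<Longrightarrow> s = t"
  unfolding least_def by (blast intro: po_antisym)

section \<open>Directed sets\<close>

lemma directed_inD:
  assumes "directed_in L D"
  shows "D \<subseteq> carrier L" "D \<noteq> {}"
    "\<And>x y. \<lbrakk>x \<in> D; y \<in> D\<rbrakk> \<Longrightarrow> \<exists>z\<in>D. x \<sqsubseteq>\<^bsub>L\<^esub> z \<and> y \<sqsubseteq>\<^bsub>L\<^esub> z"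
  using assms unfolding directed_in_def by auto

lemma directed_inI:
  assumes "D \<subseteq> carrier L" "D \<noteq> {}"
    "\<And>x y. \<lbrakk>x \<in> D; y \<in> D\<rbrakk> \<Longrightarrow> \<exists>z\<in>D. x \<sqsubseteq>\<^bsub>L\<^esub> z \<and> y \<sqsubseteq>\<^bsub>L\<^esub> z"
  shows "directed_in L D"
  using assms unfolding directed_in_def by auto

lemma directed_in_image:
  assumes "directed_in L D" "\<And>x. x \<in> D \<Longrightarrow> f x \<in> carrier M"
    and "\<And>x y. \<lbrakk>x \<in> D; y \<in> D; x \<sqsubseteq>\<^bsub>L\<^esub> y\<rbrakk> \<Longrightarrow> f x \<sqsubseteq>\<^bsub>M\<^esub> f y"
  shows "directed_in M (f ` D)"
proof (rule directed_inI)
  fix u v assume "u \<in> f ` D" "v \<in> f ` D"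
  then obtain x y where xy: "x \<in> D" "y \<in> D" "u = f x" "v = f y" by blast
  then obtain z where z: "z \<in> D" "x \<sqsubseteq>\<^bsub>L\<^esub> z" "y \<sqsubseteq>\<^bsub>L\<^esub> z"
    using directed_inD(3)[OF assms(1)] by blast
  then show "\<exists>w\<in>f ` D. u \<sqsubseteq>\<^bsub>M\<^esub> w \<and> v \<sqsubseteq>\<^bsub>M\<^esub> w" using assms(3) xy by blast
qed (use assms(2) directed_inD(2)[OF assms(1)] in auto)

text \<open>Induction adds one element at a time; the empty set is bounded because directed sets are
  nonempty. With \<open>S = D\<close> finite it yields a greatest element, which is how deflations
  arise later from finite directed sets.\<close>

lemma directed_in_finite_bound:
  assumes "partial_order L" "directed_in L D" "finite S" "S \<subseteq> D"
  shows "\<exists>z\<in>D. \<forall>x\<in>S. x \<sqsubseteq>\<^bsub>L\<^esub> z"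
  using assms(3,4)
proof (induction S rule: finite_induct)
  case empty
  then show ?case using directed_inD(2)[OF assms(2)] by auto
next
  case (insert a S)
  then obtain z where z: "z \<in> D" "\<forall>x\<in>S. x \<sqsubseteq>\<^bsub>L\<^esub> z" by auto
  with insert obtain w where w: "w \<in> D" "a \<sqsubseteq>\<^bsub>L\<^esub> w" "z \<sqsubseteq>\<^bsub>L\<^esub> w"
    using directed_inD(3)[OF assms(2), of a z] by auto
  have "x \<sqsubseteq>\<^bsub>L\<^esub> w" if "x \<in> S" for x
    using that insert.prems z w directed_inD(1)[OF assms(2)]
    by (intro po_trans[OF assms(1), of x z w]) auto
  with w show ?case by auto
qed

text \<open>A cofinal subset \<open>B\<close> of \<open>W\<close> has the same upper bounds as
  \<open>W\<close>, so directedness and the supremum pass from \<open>B\<close> to \<open>W\<close>.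
  This lets a single convenient basis replace the full set of approximants.\<close>

lemma directed_in_cofinal:
  assumes "partial_order L" "directed_in L B" "is_lub L x B" "B \<subseteq> W" "W \<subseteq> carrier L"
    and "\<And>w. w \<in> W \<Longrightarrow> \<exists>b\<in>B. w \<sqsubseteq>\<^bsub>L\<^esub> b"
  shows "directed_in L W" "is_lub L x W"
proof -
  note B = directed_inD[OF assms(2)]
  have x: "x \<in> carrier L" using assms(3) by (rule is_lub_carrier)
  show "directed_in L W"
  proof (rule directed_inI)
    fix u v assume uv: "u \<in> W" "v \<in> W"
    then obtain a b where ab: "a \<in> B" "b \<in> B" "u \<sqsubseteq>\<^bsub>L\<^esub> a" "v \<sqsubseteq>\<^bsub>L\<^esub> b" using assms(6) by blast
    then obtain c where c: "c \<in> B" "a \<sqsubseteq>\<^bsub>L\<^esub> c" "b \<sqsubseteq>\<^bsub>L\<^esub> c" using B(3) by blast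
    have "u \<sqsubseteq>\<^bsub>L\<^esub> c" "v \<sqsubseteq>\<^bsub>L\<^esub> c"
      using uv ab c assms(5) B(1) by (meson po_trans[OF assms(1)] subsetD)+
    then show "\<exists>z\<in>W. u \<sqsubseteq>\<^bsub>L\<^esub> z \<and> v \<sqsubseteq>\<^bsub>L\<^esub> z" using c assms(4) by blast
  qed (use assms B in auto)
  show "is_lub L x W"
  proof (rule is_lubI)
    fix w assume w: "w \<in> W"
    then obtain b where b: "b \<in> B" "w \<sqsubseteq>\<^bsub>L\<^esub> b" using assms(6) by blast
    show "w \<sqsubseteq>\<^bsub>L\<^esub> x"
      using po_trans[OF assms(1) b(2) is_lub_upper[OF assms(3) B(1) b(1)]] w b assms(5) B(1) x
      by auto
  next
    fix u assume "u \<in> carrier L" "\<And>w. w \<in> W \<Longrightarrow> w \<sqsubseteq>\<^bsub>L\<^esub> u"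
    then show "x \<sqsubseteq>\<^bsub>L\<^esub> u" using is_lub_least[OF assms(3) B(1)] assms(4) by blast
  qed (use assms x in auto)
qed

section \<open>Dcpos and the way-below relation\<close>

lemma dcpo_po: "dcpo L \<Longrightarrow> partial_order L"
  by (simp add: dcpo_def)

lemma dcpo_lub: "\<lbrakk>dcpo L; directed_in L D\<rbrakk> \<Longrightarrow> \<exists>s. is_lub L s D"
  by (simp add: dcpo_def)

lemma way_below_carrier: "way_below L x y \<Longrightarrow> x \<in> carrier L \<and> y \<in> carrier L"
  by (simp add: way_below_def)

lemma way_belowI:
  assumes "x \<in> carrier L" "y \<in> carrier L"
    and "\<And>D s. \<lbrakk>directed_in L D; is_lub L s D; y \<sqsubseteq>\<^bsub>L\<^esub> s\<rbrakk> \<Longrightarrow> \<exists>d\<in>D. x \<sqsubseteq>\<^bsub>L\<^esub> d"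
  shows "way_below L x y"
  using assms unfolding way_below_def by auto

lemma way_belowD:
  "\<lbrakk>way_below L x y; directed_in L D; is_lub L s D; y \<sqsubseteq>\<^bsub>L\<^esub> s\<rbrakk> \<Longrightarrow> \<exists>d\<in>D. x \<sqsubseteq>\<^bsub>L\<^esub> d"
  unfolding way_below_def by blast

lemma is_lub_singleton:
  assumes "partial_order L" "y \<in> carrier L"
  shows "directed_in L {y}" "is_lub L y {y}"
  using assms by (auto simp: directed_in_def is_lub_iff po_refl)

lemma way_below_le:
  assumes "partial_order L" "way_below L x y"
  shows "x \<sqsubseteq>\<^bsub>L\<^esub> y"
  using way_belowD[OF assms(2) is_lub_singleton[OF assms(1)]] way_below_carrier[OF assms(2)]
  by (auto simp: po_refl[OF assms(1)])

lemma way_below_mono: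
  assumes "partial_order L" "x' \<sqsubseteq>\<^bsub>L\<^esub> x" "way_below L x y" "y \<sqsubseteq>\<^bsub>L\<^esub> y'" "x' \<in> carrier L" "y' \<in> carrier L"
  shows "way_below L x' y'"
proof (rule way_belowI)
  note c = way_below_carrier[OF assms(3)]
  fix D s assume D: "directed_in L D" "is_lub L s D" "y' \<sqsubseteq>\<^bsub>L\<^esub> s"
  have "y \<sqsubseteq>\<^bsub>L\<^esub> s"
    using po_trans[OF assms(1,4) D(3)] c assms(6) is_lub_carrier[OF D(2)] by blast
  then obtain d where d: "d \<in> D" "x \<sqsubseteq>\<^bsub>L\<^esub> d" using way_belowD[OF assms(3) D(1,2)] by blast
  then show "\<exists>d\<in>D. x' \<sqsubseteq>\<^bsub>L\<^esub> d"
    using po_trans[OF assms(1,2) d(2)] assms(5) c directed_inD(1)[OF D(1)] by blast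
qed (use assms in auto)

lemma way_below_le_trans:
  "\<lbrakk>partial_order L; way_below L x y; y \<sqsubseteq>\<^bsub>L\<^esub> z; z \<in> carrier L\<rbrakk> \<Longrightarrow> way_below L x z"
  using way_below_mono[of L x x y z] way_below_carrier[of L x y] po_refl[of L x] by simp

lemma le_way_below_trans:
  "\<lbrakk>partial_order L; x \<sqsubseteq>\<^bsub>L\<^esub> y; way_below L y z; x \<in> carrier L\<rbrakk> \<Longrightarrow> way_below L x z"
  using way_below_mono[of L x y z z] way_below_carrier[of L y z] po_refl[of L z] by simp

section \<open>Continuous and algebraic dcpos\<close>

lemma continuous_dcpoD:
  assumes "continuous_dcpo L"
  shows "dcpo L" "x \<in> carrier L \<Longrightarrow> directed_in L {y. way_below L y x}"
    "x \<in> carrier L \<Longrightarrow> is_lub L x {y. way_below L y x}"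
  using assms by (auto simp: continuous_dcpo_def)

text \<open>If \<open>w\<close> is way below \<open>x\<close> and \<open>x\<close> is the supremum
  of \<open>B\<close>, then \<open>w\<close> lies below a member of \<open>B\<close>. Hence
  \<open>B\<close> is cofinal among all elements way below \<open>x\<close>.\<close>

lemma continuous_dcpoI:
  assumes "dcpo L"
    and "\<And>x. x \<in> carrier L \<Longrightarrow> \<exists>B. directed_in L B \<and> is_lub L x B \<and> (\<forall>b\<in>B. way_below L b x)"
  shows "continuous_dcpo L"
  unfolding continuous_dcpo_def
proof (intro conjI ballI assms(1))
  fix x assume x: "x \<in> carrier L"
  then obtain B where B: "directed_in L B" "is_lub L x B" "\<forall>b\<in>B. way_below L b x"
    using assms(2) by blast
  have "\<exists>b\<in>B. w \<sqsubseteq>\<^bsub>L\<^esub> b" if "way_below L w x" for w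
    using way_belowD[OF that B(1,2)] po_refl[OF dcpo_po[OF assms(1)] x] by blast
  moreover have "B \<subseteq> {y. way_below L y x}" using B(3) by blast
  moreover have "{y. way_below L y x} \<subseteq> carrier L" by (auto simp: way_below_def)
  ultimately show "directed_in L {y. way_below L y x}" "is_lub L x {y. way_below L y x}"
    using directed_in_cofinal[OF dcpo_po[OF assms(1)] B(1,2), of "{y. way_below L y x}"] by simp_all
qed

text \<open>The same cofinality argument: a compact \<open>k\<close> below \<open>x\<close> is way
  below itself, hence lies below a member of any directed set with supremum
  \<open>x\<close>.\<close>

lemma algebraic_dcpoI:
  assumes "dcpo L"
    and "\<And>x. x \<in> carrier L \<Longrightarrow> \<exists>B. directed_in L B \<and> is_lub L x B \<and> (\<forall>b\<in>B. compact_in L b)"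
  shows "algebraic_dcpo L"
  unfolding algebraic_dcpo_def
proof (intro conjI ballI assms(1))
  fix x assume x: "x \<in> carrier L"
  then obtain B where B: "directed_in L B" "is_lub L x B" "\<forall>b\<in>B. compact_in L b"
    using assms(2) by blast
  let ?W = "{k. compact_in L k \<and> k \<sqsubseteq>\<^bsub>L\<^esub> x}"
  have "\<exists>b\<in>B. w \<sqsubseteq>\<^bsub>L\<^esub> b" if "w \<in> ?W" for w
    using that way_belowD[OF _ B(1,2)] unfolding compact_in_def by blast
  moreover have "B \<subseteq> ?W" using B(3) is_lub_upper[OF B(2) directed_inD(1)[OF B(1)]] by blast
  moreover have "?W \<subseteq> carrier L" by (auto simp: compact_in_def way_below_def)
  ultimately show "directed_in L ?W" "is_lub L x ?W"
    using directed_in_cofinal[OF dcpo_po[OF assms(1)] B(1,2), of ?W] by simp_all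
qed

lemma algebraic_imp_continuous:
  assumes "algebraic_dcpo L"
  shows "continuous_dcpo L"
proof (rule continuous_dcpoI)
  show L: "dcpo L" using assms by (simp add: algebraic_dcpo_def)
  fix x assume x: "x \<in> carrier L"
  let ?B = "{k. compact_in L k \<and> k \<sqsubseteq>\<^bsub>L\<^esub> x}"
  have "way_below L b x" if "b \<in> ?B" for b
    using that x way_below_le_trans[OF dcpo_po[OF L]] by (auto simp: compact_in_def)
  then show "\<exists>B. directed_in L B \<and> is_lub L x B \<and> (\<forall>b\<in>B. way_below L b x)"
    using assms x unfolding algebraic_dcpo_def by blast
qed

text \<open>The elements way below some member of \<open>D\<close> form a directed set that still
  has supremum \<open>s\<close>, so \<open>y\<close> lies below some \<open>b\<close> that is way
  below a \<open>d\<close> in \<open>D\<close>. This is what makes the map sending \<open>x\<close>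
  to the set of elements way below it Scott continuous.\<close>

lemma way_below_lubD:
  assumes "continuous_dcpo L" "directed_in L D" "is_lub L s D" "way_below L y s"
  shows "\<exists>d\<in>D. way_below L y d"
proof -
  note L = continuous_dcpoD[OF assms(1)]
  note po = dcpo_po[OF L(1)]
  note Dc = directed_inD[OF assms(2)]
  let ?B = "\<Union>d\<in>D. {y. way_below L y d}"
  have s: "s \<in> carrier L" using assms(3) by (rule is_lub_carrier)
  have Bc: "?B \<subseteq> carrier L" using way_below_carrier by fast
  have "directed_in L ?B"
  proof (rule directed_inI)
    show "?B \<noteq> {}" using Dc(1,2) directed_inD(2)[OF L(2)] by blast
    fix u v assume "u \<in> ?B" "v \<in> ?B"
    then obtain a b where ab: "a \<in> D" "b \<in> D" "way_below L u a" "way_below L v b" by blast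
    then obtain c where c: "c \<in> D" "a \<sqsubseteq>\<^bsub>L\<^esub> c" "b \<sqsubseteq>\<^bsub>L\<^esub> c" using Dc(3) by blast
    have "way_below L u c" "way_below L v c"
      using ab c Dc(1) way_below_le_trans[OF po] by blast+
    then obtain z where "way_below L z c" "u \<sqsubseteq>\<^bsub>L\<^esub> z" "v \<sqsubseteq>\<^bsub>L\<^esub> z"
      using directed_inD(3)[OF L(2), of c u v] c(1) Dc(1) by blast
    then show "\<exists>z\<in>?B. u \<sqsubseteq>\<^bsub>L\<^esub> z \<and> v \<sqsubseteq>\<^bsub>L\<^esub> z" using c(1) by blast
  qed (rule Bc)
  moreover have "is_lub L s ?B"
  proof (rule is_lubI)
    fix x assume "x \<in> ?B"
    then obtain d where d: "d \<in> D" "way_below L x d" by blast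
    show "x \<sqsubseteq>\<^bsub>L\<^esub> s"
      using po_trans[OF po way_below_le[OF po d(2)] is_lub_upper[OF assms(3) Dc(1) d(1)]]
        s way_below_carrier[OF d(2)] by blast
  next
    fix u assume u: "u \<in> carrier L" "\<And>x. x \<in> ?B \<Longrightarrow> x \<sqsubseteq>\<^bsub>L\<^esub> u"
    show "s \<sqsubseteq>\<^bsub>L\<^esub> u"
    proof (rule is_lub_least[OF assms(3) Dc(1) u(1)])
      fix d assume d: "d \<in> D"
      then have "d \<in> carrier L" using Dc(1) by blast
      from is_lub_least[OF L(3)[OF this] directed_inD(1)[OF L(2)[OF this]] u(1)]
      show "d \<sqsubseteq>\<^bsub>L\<^esub> u" using u(2) d by blast
    qed
  qed (use Bc s in auto)
  ultimately obtain b where b: "b \<in> ?B" "y \<sqsubseteq>\<^bsub>L\<^esub> b"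
    using way_belowD[OF assms(4)] po_refl[OF po s] by blast
  then obtain d where d: "d \<in> D" "way_below L b d" by blast
  have "way_below L y d"
    using le_way_below_trans[OF po b(2) d(2)] way_below_carrier[OF assms(4)] by blast
  with d show ?thesis by blast
qed

section \<open>Function spaces\<close>

text \<open>Monotonicity already makes \<open>f s\<close> an upper bound of the image, so the last
  premise asks only for leastness.\<close>

lemma scott_continuousI:
  assumes "partial_order X" "partial_order Y"
    and "\<And>x. x \<in> carrier X \<Longrightarrow> f x \<in> carrier Y"
    and "\<And>x y. \<lbrakk>x \<in> carrier X; y \<in> carrier X; x \<sqsubseteq>\<^bsub>X\<^esub> y\<rbrakk> \<Longrightarrow> f x \<sqsubseteq>\<^bsub>Y\<^esub> f y"
    and "\<And>D s u. \<lbrakk>directed_in X D; is_lub X s D; s \<in> carrier X; u \<in> carrier Y;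
      \<And>d. d \<in> D \<Longrightarrow> f d \<sqsubseteq>\<^bsub>Y\<^esub> u\<rbrakk> \<Longrightarrow> f s \<sqsubseteq>\<^bsub>Y\<^esub> u"
  shows "scott_continuous X Y f"
  unfolding scott_continuous_def isotone_def
proof (intro conjI ballI allI impI)
  fix D s assume D: "directed_in X D" "is_lub X s D"
  note Dc = directed_inD[OF D(1)]
  have s: "s \<in> carrier X" using D(2) by (rule is_lub_carrier)
  show "is_lub Y (f s) (f ` D)"
  proof (rule is_lubI)
    fix y assume "y \<in> f ` D"
    then show "y \<sqsubseteq>\<^bsub>Y\<^esub> f s" using Dc(1) s is_lub_upper[OF D(2) Dc(1)] assms(4) by blast
  next
    fix u assume "u \<in> carrier Y" "\<And>y. y \<in> f ` D \<Longrightarrow> y \<sqsubseteq>\<^bsub>Y\<^esub> u"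
    then show "f s \<sqsubseteq>\<^bsub>Y\<^esub> u" using assms(5)[OF D s] by blast
  qed (use Dc(1) s assms(3) in auto)
qed (use assms in \<open>auto dest: partial_order.axioms(1)\<close>)

lemma scott_continuousD:
  assumes "scott_continuous X Y f"
  shows "x \<in> carrier X \<Longrightarrow> f x \<in> carrier Y"
    and "\<lbrakk>x \<in> carrier X; y \<in> carrier X; x \<sqsubseteq>\<^bsub>X\<^esub> y\<rbrakk> \<Longrightarrow> f x \<sqsubseteq>\<^bsub>Y\<^esub> f y"
    and "\<lbrakk>directed_in X D; is_lub X s D\<rbrakk> \<Longrightarrow> is_lub Y (f s) (f ` D)"
  using assms unfolding scott_continuous_def isotone_def by auto

lemma scott_continuous_directed_image:
  assumes "scott_continuous X Y f" "directed_in X D"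
  shows "directed_in Y (f ` D)"
  using directed_inD(1)[OF assms(2)]
  by (intro directed_in_image[OF assms(2)])
    (auto simp: subset_iff intro: scott_continuousD(1,2)[OF assms(1)])

text \<open>The conditions are stated for the raw map, and the restriction is applied afterwards,
  because elements of the function space are extensional.\<close>

lemma fun_space_carrierI:
  assumes "partial_order X" "partial_order Y"
    and "\<And>x. x \<in> carrier X \<Longrightarrow> f x \<in> carrier Y"
    and "\<And>x y. \<lbrakk>x \<in> carrier X; y \<in> carrier X; x \<sqsubseteq>\<^bsub>X\<^esub> y\<rbrakk> \<Longrightarrow> f x \<sqsubseteq>\<^bsub>Y\<^esub> f y"
    and "\<And>D s u. \<lbrakk>directed_in X D; is_lub X s D; s \<in> carrier X; u \<in> carrier Y;
      \<And>d. d \<in> D \<Longrightarrow> f d \<sqsubseteq>\<^bsub>Y\<^esub> u\<rbrakk> \<Longrightarrow> f s \<sqsubseteq>\<^bsub>Y\<^esub> u"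
  shows "restrict f (carrier X) \<in> carrier (fun_space X Y)"
proof -
  have "scott_continuous X Y (restrict f (carrier X))"
  proof (rule scott_continuousI[OF assms(1,2)])
    fix D s u
    assume D: "directed_in X D" "is_lub X s D" "s \<in> carrier X" "u \<in> carrier Y"
      and u: "\<And>d. d \<in> D \<Longrightarrow> restrict f (carrier X) d \<sqsubseteq>\<^bsub>Y\<^esub> u"
    have "f d \<sqsubseteq>\<^bsub>Y\<^esub> u" if "d \<in> D" for d
      using u[OF that] that directed_inD(1)[OF D(1)] by (auto simp: subset_iff)
    then show "restrict f (carrier X) s \<sqsubseteq>\<^bsub>Y\<^esub> u" using assms(5)[OF D] D(3) by simp
  qed (use assms in auto)
  then show ?thesis using assms(3) by (simp add: fun_space_def)
qed

lemma fun_spaceD: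
  assumes "f \<in> carrier (fun_space X Y)"
  shows "scott_continuous X Y f" "f \<in> extensional (carrier X)" "x \<in> carrier X \<Longrightarrow> f x \<in> carrier Y"
  using assms by (auto simp: fun_space_def PiE_def)

lemma fun_space_eval_subset:
  assumes "D \<subseteq> carrier (fun_space X Y)" "x \<in> carrier X"
  shows "(\<lambda>f. f x) ` D \<subseteq> carrier Y"
proof (rule image_subsetI)
  fix f assume "f \<in> D"
  then have "f \<in> carrier (fun_space X Y)" using assms(1) by blast
  then show "f x \<in> carrier Y" using assms(2) by (rule fun_spaceD(3))
qed

lemma fun_space_le: "f \<sqsubseteq>\<^bsub>fun_space X Y\<^esub> g \<longleftrightarrow> (\<forall>x\<in>carrier X. f x \<sqsubseteq>\<^bsub>Y\<^esub> g x)"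
  by (simp add: fun_space_def)

lemma fun_space_po:
  assumes "partial_order Y"
  shows "partial_order (fun_space X Y)"
proof (rule partial_orderI)
  fix f g assume fg: "f \<sqsubseteq>\<^bsub>fun_space X Y\<^esub> g" "g \<sqsubseteq>\<^bsub>fun_space X Y\<^esub> f"
    "f \<in> carrier (fun_space X Y)" "g \<in> carrier (fun_space X Y)"
  show "f = g"
  proof (rule extensionalityI[of _ "carrier X"])
    fix x assume "x \<in> carrier X"
    then show "f x = g x" using fg fun_spaceD(3) po_antisym[OF assms] unfolding fun_space_le by metis
  qed (use fg fun_spaceD(2) in auto)
next
  fix f g h assume "f \<sqsubseteq>\<^bsub>fun_space X Y\<^esub> g" "g \<sqsubseteq>\<^bsub>fun_space X Y\<^esub> h" "f \<in> carrier (fun_space X Y)"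
    "g \<in> carrier (fun_space X Y)" "h \<in> carrier (fun_space X Y)"
  then show "f \<sqsubseteq>\<^bsub>fun_space X Y\<^esub> h"
    unfolding fun_space_le by (meson fun_spaceD(3) po_trans[OF assms])
next
  fix f assume "f \<in> carrier (fun_space X Y)"
  then show "f \<sqsubseteq>\<^bsub>fun_space X Y\<^esub> f"
    using po_refl[OF assms] fun_spaceD(3) unfolding fun_space_le by metis
qed (simp add: fun_space_def)

lemma fun_space_directed_eval:
  assumes "directed_in (fun_space X Y) D" "x \<in> carrier X"
  shows "directed_in Y ((\<lambda>f. f x) ` D)"
proof (rule directed_in_image[OF assms(1)])
  show "f x \<in> carrier Y" if "f \<in> D" for f
    using fun_space_eval_subset[OF directed_inD(1)[OF assms(1)] assms(2)] that by blast
  show "f x \<sqsubseteq>\<^bsub>Y\<^esub> g x" if "f \<sqsubseteq>\<^bsub>fun_space X Y\<^esub> g" for f g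
    using that assms(2) by (simp add: fun_space_le)
qed

text \<open>The pointwise supremum \<open>p\<close> is Scott continuous because suprema commute: if
  \<open>u\<close> bounds all \<open>p d\<close>, then each \<open>f\<close> in \<open>D\<close>
  satisfies \<open>f d \<sqsubseteq> p d \<sqsubseteq> u\<close>, so \<open>f s\<close>, the
  supremum of the \<open>f d\<close>, is below \<open>u\<close>, and therefore so is
  \<open>p s\<close>.\<close>

lemma fun_space_pointwise_lub:
  assumes X: "partial_order X" and Y: "dcpo Y" and D: "directed_in (fun_space X Y) D"
  shows "\<exists>s. is_lub (fun_space X Y) s D \<and> (\<forall>x\<in>carrier X. is_lub Y (s x) ((\<lambda>f. f x) ` D))"
proof -
  note po = dcpo_po[OF Y]
  note Dc = directed_inD[OF D]
  define p where "p x = (SOME t. is_lub Y t ((\<lambda>f. f x) ` D))" for x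
  have sub: "(\<lambda>f. f x) ` D \<subseteq> carrier Y" if "x \<in> carrier X" for x
    using Dc(1) that by (rule fun_space_eval_subset)
  have p: "is_lub Y (p x) ((\<lambda>f. f x) ` D)" if "x \<in> carrier X" for x
    unfolding p_def using dcpo_lub[OF Y fun_space_directed_eval[OF D that]] by (rule someI_ex)
  have pc: "p x \<in> carrier Y" if "x \<in> carrier X" for x using is_lub_carrier[OF p[OF that]] .
  have up: "f x \<sqsubseteq>\<^bsub>Y\<^esub> p x" if "x \<in> carrier X" "f \<in> D" for f x
    using is_lub_upper[OF p sub] that by blast
  have fc: "f x \<in> carrier Y" "scott_continuous X Y f" if "f \<in> D" "x \<in> carrier X" for f x
    using sub[OF that(2)] that(1) fun_spaceD(1)[of f X Y] Dc(1) by auto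
  have pcar: "restrict p (carrier X) \<in> carrier (fun_space X Y)"
  proof (rule fun_space_carrierI[OF X po])
    fix x y assume xy: "x \<in> carrier X" "y \<in> carrier X" "x \<sqsubseteq>\<^bsub>X\<^esub> y"
    show "p x \<sqsubseteq>\<^bsub>Y\<^esub> p y"
    proof (rule is_lub_least[OF p sub])
      fix v assume "v \<in> (\<lambda>f. f x) ` D"
      then obtain f where f: "f \<in> D" "v = f x" by blast
      have "f x \<sqsubseteq>\<^bsub>Y\<^esub> f y" using fc(2)[OF f(1) xy(1)] xy by (rule scott_continuousD(2))
      from po_trans[OF po this up[OF xy(2) f(1)] fc(1)[OF f(1) xy(1)] fc(1)[OF f(1) xy(2)] pc[OF xy(2)]]
      show "v \<sqsubseteq>\<^bsub>Y\<^esub> p y" using f(2) by simp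
    qed (use xy pc in auto)
  next
    fix S s u
    assume S: "directed_in X S" "is_lub X s S" "s \<in> carrier X" "u \<in> carrier Y"
      and u: "\<And>d. d \<in> S \<Longrightarrow> p d \<sqsubseteq>\<^bsub>Y\<^esub> u"
    note Sc = directed_inD(1)[OF S(1)]
    show "p s \<sqsubseteq>\<^bsub>Y\<^esub> u"
    proof (rule is_lub_least[OF p sub])
      fix v assume "v \<in> (\<lambda>f. f s) ` D"
      then obtain f where f: "f \<in> D" "v = f s" by blast
      have "f s \<sqsubseteq>\<^bsub>Y\<^esub> u"
      proof (rule is_lub_least[OF scott_continuousD(3)[OF fc(2)[OF f(1) S(3)] S(1,2)]])
        fix w assume "w \<in> f ` S"
        then obtain d where d: "d \<in> S" "w = f d" by blast
        then have "d \<in> carrier X" using Sc by blast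
        from po_trans[OF po up[OF this f(1)] u[OF d(1)] fc(1)[OF f(1) this] pc[OF this] S(4)]
        show "w \<sqsubseteq>\<^bsub>Y\<^esub> u" using d(2) by simp
      next
        show "f ` S \<subseteq> carrier Y" using Sc fc(1)[OF f(1)] by blast
      qed (rule S(4))
      then show "v \<sqsubseteq>\<^bsub>Y\<^esub> u" using f by simp
    qed (use S in auto)
  qed (use pc in auto)
  show ?thesis
  proof (intro exI conjI ballI)
    show "is_lub (fun_space X Y) (restrict p (carrier X)) D"
    proof (rule is_lubI[OF Dc(1) pcar])
      fix u assume u: "u \<in> carrier (fun_space X Y)" "\<And>f. f \<in> D \<Longrightarrow> f \<sqsubseteq>\<^bsub>fun_space X Y\<^esub> u"
      have "p x \<sqsubseteq>\<^bsub>Y\<^esub> u x" if x: "x \<in> carrier X" for x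
        using u x fun_spaceD(3)[OF u(1) x]
        by (intro is_lub_least[OF p sub]) (auto simp: fun_space_le)
      then show "restrict p (carrier X) \<sqsubseteq>\<^bsub>fun_space X Y\<^esub> u" by (simp add: fun_space_le)
    qed (use up in \<open>auto simp: fun_space_le\<close>)
    show "is_lub Y (restrict p (carrier X) x) ((\<lambda>f. f x) ` D)" if "x \<in> carrier X" for x
      using p[OF that] that by simp
  qed
qed

lemma fun_space_dcpo:
  assumes "partial_order X" "dcpo Y"
  shows "dcpo (fun_space X Y)"
  unfolding dcpo_def
proof (intro conjI allI impI)
  show "partial_order (fun_space X Y)" using dcpo_po[OF assms(2)] by (rule fun_space_po)
  fix D assume D: "directed_in (fun_space X Y) D"
  show "\<exists>s. is_lub (fun_space X Y) s D"
    using fun_space_pointwise_lub[OF assms D] by (elim exE conjE) (rule exI)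
qed

text \<open>Suprema are unique, so every supremum in the function space is the pointwise one
  constructed above.\<close>

lemma fun_space_lubD:
  assumes "partial_order X" "dcpo Y" "directed_in (fun_space X Y) D" "is_lub (fun_space X Y) s D"
    and "x \<in> carrier X"
  shows "is_lub Y (s x) ((\<lambda>f. f x) ` D)"
proof -
  obtain t where t: "is_lub (fun_space X Y) t D"
    "\<forall>x\<in>carrier X. is_lub Y (t x) ((\<lambda>f. f x) ` D)"
    using fun_space_pointwise_lub[OF assms(1-3)] by (elim exE conjE)
  have "s = t" by (rule is_lub_same[OF fun_space_po[OF dcpo_po[OF assms(2)]] assms(4) t(1)])
  with bspec[OF t(2) assms(5)] show ?thesis by simp
qed

section \<open>Function spaces out of RB-domains\<close>

text \<open>Induction on the size of \<open>F\<close>, with a maximal point \<open>m\<close> treated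
  last: its value only has to dominate finitely many elements way below \<open>f m\<close>, and the
  set of those is directed. The finite sets \<open>S a\<close> are prescribed lower bounds;
  different choices of them give nonemptiness, directedness and the supremum property of the basis
  built below.\<close>

lemma ex_way_below_monotone_approximant:
  assumes X: "partial_order X" and E: "continuous_dcpo E"
    and F: "finite F" "F \<subseteq> carrier X"
    and f: "\<And>x. x \<in> carrier X \<Longrightarrow> f x \<in> carrier E"
      "\<And>x y. \<lbrakk>x \<in> carrier X; y \<in> carrier X; x \<sqsubseteq>\<^bsub>X\<^esub> y\<rbrakk> \<Longrightarrow> f x \<sqsubseteq>\<^bsub>E\<^esub> f y"
    and S: "\<And>a. a \<in> F \<Longrightarrow> finite (S a)" "\<And>a e. \<lbrakk>a \<in> F; e \<in> S a\<rbrakk> \<Longrightarrow> way_below E e (f a)"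
  shows "\<exists>g. (\<forall>a\<in>F. way_below E (g a) (f a) \<and> (\<forall>e\<in>S a. e \<sqsubseteq>\<^bsub>E\<^esub> g a)) \<and>
    (\<forall>a\<in>F. \<forall>b\<in>F. a \<sqsubseteq>\<^bsub>X\<^esub> b \<longrightarrow> g a \<sqsubseteq>\<^bsub>E\<^esub> g b)"
  using F S
proof (induction "card F" arbitrary: F)
  case 0
  then show ?case by simp
next
  case (Suc n)
  note poE = dcpo_po[OF continuous_dcpoD(1)[OF E]]
  \<comment> \<open>A maximal element of \<open>F\<close> is obtained from the strict part of the
    order, since \<open>bex_max_element\<close> asks for an asymmetric and transitive
    relation.\<close>
  have "F \<noteq> {}" using Suc.hyps(2) by auto
  moreover have "asymp_on F (\<lambda>x y. x \<sqsubseteq>\<^bsub>X\<^esub> y \<and> x \<noteq> y)"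
    by (rule asymp_onI) (use Suc.prems(2) po_antisym[OF X] in blast)
  moreover have "transp_on F (\<lambda>x y. x \<sqsubseteq>\<^bsub>X\<^esub> y \<and> x \<noteq> y)"
  proof (rule transp_onI)
    fix x y z assume c: "x \<in> F" "y \<in> F" "z \<in> F"
      and le: "x \<sqsubseteq>\<^bsub>X\<^esub> y \<and> x \<noteq> y" "y \<sqsubseteq>\<^bsub>X\<^esub> z \<and> y \<noteq> z"
    have "x \<in> carrier X" "y \<in> carrier X" "z \<in> carrier X" using c Suc.prems(2) by auto
    then show "x \<sqsubseteq>\<^bsub>X\<^esub> z \<and> x \<noteq> z"
      using le po_trans[OF X, of x y z] po_antisym[OF X, of x y] by blast
  qed
  ultimately obtain m where m: "m \<in> F" "\<And>x. \<lbrakk>x \<in> F; m \<sqsubseteq>\<^bsub>X\<^esub> x\<rbrakk> \<Longrightarrow> x = m"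
    using Finite_Set.bex_max_element[OF Suc.prems(1)] by blast
  let ?G = "F - {m}"
  have "n = card ?G" using Suc.hyps(2) m(1) Suc.prems(1) by simp
  then have "\<exists>g. (\<forall>a\<in>?G. way_below E (g a) (f a) \<and> (\<forall>e\<in>S a. e \<sqsubseteq>\<^bsub>E\<^esub> g a)) \<and>
      (\<forall>a\<in>?G. \<forall>b\<in>?G. a \<sqsubseteq>\<^bsub>X\<^esub> b \<longrightarrow> g a \<sqsubseteq>\<^bsub>E\<^esub> g b)"
    using Suc.prems by (intro Suc.hyps(1)) auto
  then obtain g where g0: "\<forall>a\<in>?G. way_below E (g a) (f a) \<and> (\<forall>e\<in>S a. e \<sqsubseteq>\<^bsub>E\<^esub> g a)"
    "\<forall>a\<in>?G. \<forall>b\<in>?G. a \<sqsubseteq>\<^bsub>X\<^esub> b \<longrightarrow> g a \<sqsubseteq>\<^bsub>E\<^esub> g b"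
    by (elim exE conjE)
  have g: "way_below E (g a) (f a)" "\<And>e. e \<in> S a \<Longrightarrow> e \<sqsubseteq>\<^bsub>E\<^esub> g a" if "a \<in> ?G" for a
    using bspec[OF g0(1) that] by simp_all
  have g_mono: "g a \<sqsubseteq>\<^bsub>E\<^esub> g b" if "a \<in> ?G" "b \<in> ?G" "a \<sqsubseteq>\<^bsub>X\<^esub> b" for a b
    using g0(2) that by blast
  have mX: "m \<in> carrier X" using m(1) Suc.prems(2) by blast
  \<comment> \<open>All elements that the value at \<open>m\<close> must dominate: the prescribed
    ones and the values already chosen at points below \<open>m\<close>. The latter are way below
    \<open>f m\<close> because \<open>f b \<sqsubseteq> f m\<close>.\<close>
  let ?T = "S m \<union> g ` {b \<in> ?G. b \<sqsubseteq>\<^bsub>X\<^esub> m}"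
  have "finite ?T" using Suc.prems(1,3) m(1) by simp
  moreover have "way_below E e (f m)" if "e \<in> ?T" for e
  proof (cases "e \<in> S m")
    case False
    with that obtain b where b: "b \<in> ?G" "b \<sqsubseteq>\<^bsub>X\<^esub> m" "e = g b" by blast
    then have "f b \<sqsubseteq>\<^bsub>E\<^esub> f m" using f(2) mX Suc.prems(2) by blast
    then show ?thesis using way_below_le_trans[OF poE g(1)[OF b(1)]] f(1)[OF mX] b(3) by simp
  qed (use Suc.prems(4) m(1) in blast)
  ultimately obtain z where z: "way_below E z (f m)" "\<And>e. e \<in> ?T \<Longrightarrow> e \<sqsubseteq>\<^bsub>E\<^esub> z"
    using directed_in_finite_bound[OF poE continuous_dcpoD(2)[OF E f(1)[OF mX]], of ?T] by blast
  have zz: "z \<sqsubseteq>\<^bsub>E\<^esub> z" using way_below_carrier[OF z(1)] po_refl[OF poE] by blast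
  let ?g = "g(m := z)"
  have "way_below E (?g a) (f a) \<and> (\<forall>e\<in>S a. e \<sqsubseteq>\<^bsub>E\<^esub> ?g a)" if "a \<in> F" for a
    using that g(1,2) z by (cases "a = m") auto
  \<comment> \<open>No other point of \<open>F\<close> lies above \<open>m\<close>, so the new value
    occurs on the left of an inequality only when both points are \<open>m\<close>.\<close>
  moreover have "?g a \<sqsubseteq>\<^bsub>E\<^esub> ?g b" if "a \<in> F" "b \<in> F" "a \<sqsubseteq>\<^bsub>X\<^esub> b" for a b
  proof (cases "a = m")
    case True
    with m(2) that have "b = m" by blast
    with True zz show ?thesis by simp
  next
    case False
    then show ?thesis using that g_mono z(2) by (cases "b = m") auto
  qed
  ultimately show ?case by (intro exI[of _ ?g] conjI ballI impI) blast+
qed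

lemma deflationD:
  assumes "deflation X d"
  shows "d \<in> carrier (fun_space X X)" "scott_continuous X X d" "finite (d ` carrier X)"
    "x \<in> carrier X \<Longrightarrow> d x \<sqsubseteq>\<^bsub>X\<^esub> x" "x \<in> carrier X \<Longrightarrow> d x \<in> carrier X"
proof -
  show d: "d \<in> carrier (fun_space X X)" and "finite (d ` carrier X)"
    and "x \<in> carrier X \<Longrightarrow> d x \<sqsubseteq>\<^bsub>X\<^esub> x"
    using assms unfolding deflation_def by blast+
  show "scott_continuous X X d" "x \<in> carrier X \<Longrightarrow> d x \<in> carrier X"
    using fun_spaceD(1,3)[OF d] by blast+
qed

text \<open>The image of \<open>D\<close> under \<open>d\<close> is finite and directed, so its
  supremum \<open>d s\<close> is one of its members. Consequently \<open>g \<circ> d\<close> is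
  Scott continuous as soon as \<open>g\<close> is monotone on the image of \<open>d\<close>.\<close>

lemma deflation_attains_lub:
  assumes X: "partial_order X" and d: "deflation X d" and D: "directed_in X D" "is_lub X s D"
  shows "\<exists>a\<in>D. d a = d s"
proof -
  note Dc = directed_inD(1)[OF D(1)]
  have img: "directed_in X (d ` D)"
    by (rule scott_continuous_directed_image[OF deflationD(2)[OF d] D(1)])
  have "finite (d ` D)" using deflationD(3)[OF d] Dc by (meson finite_subset image_mono)
  then obtain a where a: "a \<in> D" "\<And>b. b \<in> D \<Longrightarrow> d b \<sqsubseteq>\<^bsub>X\<^esub> d a"
    using directed_in_finite_bound[OF X img, of "d ` D"] by auto
  have lub: "is_lub X (d s) (d ` D)" by (rule scott_continuousD(3)[OF deflationD(2)[OF d] D])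
  have "d s \<sqsubseteq>\<^bsub>X\<^esub> d a" "d a \<sqsubseteq>\<^bsub>X\<^esub> d s"
    using is_lub_least[OF lub directed_inD(1)[OF img]] is_lub_upper[OF lub directed_inD(1)[OF img]]
      a directed_inD(1)[OF img] by blast+
  then have "d a = d s" using po_antisym[OF X] a(1) directed_inD(1)[OF img] is_lub_carrier[OF lub] by blast
  with a(1) show ?thesis by blast
qed

lemma RB_domain_imp_fun_space_continuous:
  fixes X :: "'a gorder" and E :: "'e gorder"
  assumes RB: "RB_domain X" and E: "continuous_dcpo E"
  shows "continuous_dcpo (fun_space X E)"
proof (rule continuous_dcpoI)
  have X: "partial_order X"
    using RB dcpo_po unfolding RB_domain_def cont_domain_def continuous_dcpo_def by blast
  obtain \<D> where \<D>: "directed_in (fun_space X X) \<D>" "\<And>d. d \<in> \<D> \<Longrightarrow> deflation X d"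
      "is_lub (fun_space X X) (restrict id (carrier X)) \<D>"
    using RB unfolding RB_domain_def by blast
  note dE = continuous_dcpoD(1)[OF E]
  note poE = dcpo_po[OF dE]
  have dX: "dcpo X"
    using RB unfolding RB_domain_def cont_domain_def continuous_dcpo_def by blast
  show dcpo: "dcpo (fun_space X E)" by (rule fun_space_dcpo[OF X dE])
  fix f assume f: "f \<in> carrier (fun_space X E)"
  note fc = fun_spaceD(3)[OF f]
  note fm = scott_continuousD(2)[OF fun_spaceD(1)[OF f]]
  \<comment> \<open>\<open>g\<close> is constrained only on the finite image of \<open>d\<close>;
    elsewhere its values are arbitrary and never enter \<open>g \<circ> d\<close>.\<close>
  define P where "P d g \<longleftrightarrow> d \<in> \<D> \<and> (\<forall>a\<in>d ` carrier X. way_below E (g a) (f a)) \<and>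
    (\<forall>a\<in>d ` carrier X. \<forall>b\<in>d ` carrier X. a \<sqsubseteq>\<^bsub>X\<^esub> b \<longrightarrow> g a \<sqsubseteq>\<^bsub>E\<^esub> g b)" for d g
  define B where "B = {\<lambda>x\<in>carrier X. g (d x) | d g. P d g}"
  have dc: "d x \<in> carrier X" "d x \<sqsubseteq>\<^bsub>X\<^esub> x" if "d \<in> \<D>" "x \<in> carrier X" for d x
    using deflationD(4,5)[OF \<D>(2)[OF that(1)] that(2)] by simp_all
  have ex: "\<exists>g. P d g \<and> (\<forall>a\<in>d ` carrier X. \<forall>e\<in>S a. e \<sqsubseteq>\<^bsub>E\<^esub> g a)"
    if d: "d \<in> \<D>" and S: "\<And>a. a \<in> d ` carrier X \<Longrightarrow> finite (S a)"
      "\<And>a e. \<lbrakk>a \<in> d ` carrier X; e \<in> S a\<rbrakk> \<Longrightarrow> way_below E e (f a)" for d S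
  proof -
    have "d ` carrier X \<subseteq> carrier X" using dc(1)[OF d] by blast
    then have "\<exists>g. (\<forall>a\<in>d ` carrier X. way_below E (g a) (f a) \<and> (\<forall>e\<in>S a. e \<sqsubseteq>\<^bsub>E\<^esub> g a)) \<and>
      (\<forall>a\<in>d ` carrier X. \<forall>b\<in>d ` carrier X. a \<sqsubseteq>\<^bsub>X\<^esub> b \<longrightarrow> g a \<sqsubseteq>\<^bsub>E\<^esub> g b)"
      by (rule ex_way_below_monotone_approximant[OF X E deflationD(3)[OF \<D>(2)[OF d]]])
        (rule fc fm S; assumption)+
    then obtain g where g: "\<forall>a\<in>d ` carrier X. way_below E (g a) (f a) \<and> (\<forall>e\<in>S a. e \<sqsubseteq>\<^bsub>E\<^esub> g a)"
      "\<forall>a\<in>d ` carrier X. \<forall>b\<in>d ` carrier X. a \<sqsubseteq>\<^bsub>X\<^esub> b \<longrightarrow> g a \<sqsubseteq>\<^bsub>E\<^esub> g b"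
      by (elim exE conjE)
    have "P d g" unfolding P_def using d g(2) bspec[OF g(1)] by blast
    moreover have "\<forall>a\<in>d ` carrier X. \<forall>e\<in>S a. e \<sqsubseteq>\<^bsub>E\<^esub> g a" using bspec[OF g(1)] by blast
    ultimately show ?thesis by (intro exI[of _ g] conjI)
  qed
  have PD: "d \<in> \<D>" if "P d g" for d g
    using that unfolding P_def by (elim conjE)
  have P_mono: "g a \<sqsubseteq>\<^bsub>E\<^esub> g b"
    if "P d g" "a \<in> d ` carrier X" "b \<in> d ` carrier X" "a \<sqsubseteq>\<^bsub>X\<^esub> b" for d g a b
    using that unfolding P_def by blast
  have Pwb: "way_below E (g (d x)) (f (d x))" "g (d x) \<in> carrier E"
    if "P d g" "x \<in> carrier X" for d g x
  proof -
    have "d x \<in> d ` carrier X" using that(2) by (rule imageI)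
    then show "way_below E (g (d x)) (f (d x))" using that(1) unfolding P_def by blast
    then show "g (d x) \<in> carrier E" using way_below_carrier by fast
  qed
  have Bc: "(\<lambda>x\<in>carrier X. g (d x)) \<in> carrier (fun_space X E)" if P: "P d g" for d g
  proof (rule fun_space_carrierI[OF X poE])
    show "g (d x) \<in> carrier E" if "x \<in> carrier X" for x using Pwb(2)[OF P that] .
    have defl: "deflation X d" by (rule \<D>(2)[OF PD[OF P]])
    show "g (d x) \<sqsubseteq>\<^bsub>E\<^esub> g (d y)" if "x \<in> carrier X" "y \<in> carrier X" "x \<sqsubseteq>\<^bsub>X\<^esub> y" for x y
      by (rule P_mono[OF P imageI[OF that(1)] imageI[OF that(2)]
            scott_continuousD(2)[OF deflationD(2)[OF defl] that]])
    fix D s u assume D: "directed_in X D" "is_lub X s D" "\<And>x. x \<in> D \<Longrightarrow> g (d x) \<sqsubseteq>\<^bsub>E\<^esub> u"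
    obtain a where "a \<in> D" "d a = d s" using deflation_attains_lub[OF X defl D(1,2)] by blast
    then show "g (d s) \<sqsubseteq>\<^bsub>E\<^esub> u" using D(3)[of a] by simp
  qed
  have Bwb: "way_below (fun_space X E) (\<lambda>x\<in>carrier X. g (d x)) f" if P: "P d g" for d g
  proof (rule way_belowI[OF Bc[OF P] f])
    fix H s assume H: "directed_in (fun_space X E) H" "is_lub (fun_space X E) s H"
      and fs: "f \<sqsubseteq>\<^bsub>fun_space X E\<^esub> s"
    note Hc = directed_inD(1)[OF H(1)]
    have d: "d \<in> \<D>" using P by (rule PD)
    \<comment> \<open>Each of the finitely many image points \<open>a\<close> selects a member of
      \<open>H\<close> that dominates \<open>g a\<close> at \<open>a\<close>; directedness then
      gives one \<open>h\<close> above all of them.\<close>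
    have "\<exists>h\<in>H. g a \<sqsubseteq>\<^bsub>E\<^esub> h a" if a: "a \<in> d ` carrier X" for a
    proof -
      have aX: "a \<in> carrier X" using a dc(1)[OF d] by blast
      have "way_below E (g a) (f a)" using P a unfolding P_def by blast
      from way_belowD[OF this fun_space_directed_eval[OF H(1) aX] fun_space_lubD[OF X dE H aX]]
      show ?thesis using fs aX unfolding fun_space_le by blast
    qed
    then have "\<forall>a\<in>d ` carrier X. \<exists>h. h \<in> H \<and> g a \<sqsubseteq>\<^bsub>E\<^esub> h a" by blast
    from bchoice[OF this] obtain k where k0: "\<forall>a\<in>d ` carrier X. k a \<in> H \<and> g a \<sqsubseteq>\<^bsub>E\<^esub> k a a"
      by (elim exE)
    note k = bspec[OF k0]
    have "k ` d ` carrier X \<subseteq> H" using k by blast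
    then obtain h where h: "h \<in> H" "\<And>a. a \<in> d ` carrier X \<Longrightarrow> k a \<sqsubseteq>\<^bsub>fun_space X E\<^esub> h"
      using directed_in_finite_bound[OF fun_space_po[OF poE] H(1), of "k ` d ` carrier X"]
        deflationD(3)[OF \<D>(2)[OF d]] by auto
    \<comment> \<open>The chain \<open>g (d x) \<sqsubseteq> k (d x) (d x) \<sqsubseteq> h (d x)
      \<sqsubseteq> h x\<close>: the last inequality is where \<open>d x \<sqsubseteq> x\<close>
      enters.\<close>
    have "g (d x) \<sqsubseteq>\<^bsub>E\<^esub> h x" if x: "x \<in> carrier X" for x
    proof -
      note dx = dc[OF d x]
      have hc: "h \<in> carrier (fun_space X E)" and kc: "k (d x) \<in> carrier (fun_space X E)"
        using h(1) k x Hc by blast+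
      note c = fun_spaceD(3)[OF hc dx(1)] fun_spaceD(3)[OF hc x] fun_spaceD(3)[OF kc dx(1)]
      have "g (d x) \<sqsubseteq>\<^bsub>E\<^esub> k (d x) (d x)" using k x by blast
      moreover have "k (d x) (d x) \<sqsubseteq>\<^bsub>E\<^esub> h (d x)" using h(2) x dx(1) unfolding fun_space_le by blast
      moreover have "h (d x) \<sqsubseteq>\<^bsub>E\<^esub> h x" by (rule scott_continuousD(2)[OF fun_spaceD(1)[OF hc] dx(1) x dx(2)])
      ultimately show ?thesis
        using po_trans[OF poE, of "k (d x) (d x)" "h (d x)" "h x"]
          po_trans[OF poE, of "g (d x)" "k (d x) (d x)" "h x"] c Pwb(2)[OF P x] by blast
    qed
    then show "\<exists>h\<in>H. (\<lambda>x\<in>carrier X. g (d x)) \<sqsubseteq>\<^bsub>fun_space X E\<^esub> h"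
      using h(1) by (auto simp: fun_space_le)
  qed
  have BI: "(\<lambda>x\<in>carrier X. g (d x)) \<in> B" if "P d g" for d g
    using that unfolding B_def by blast
  have B_wb: "way_below (fun_space X E) b f" if b: "b \<in> B" for b
  proof -
    obtain d g where "b = (\<lambda>x\<in>carrier X. g (d x))" "P d g" using b unfolding B_def by blast
    then show ?thesis using Bwb[of d g] by simp
  qed
  have sub: "B \<subseteq> carrier (fun_space X E)" using Bc unfolding B_def by blast
  have "directed_in (fun_space X E) B"
  proof (rule directed_inI[OF sub])
    obtain d where d: "d \<in> \<D>" using directed_inD(2)[OF \<D>(1)] by blast
    obtain g where "P d g" using ex[OF d, of "\<lambda>_. {}"] by auto
    then show "B \<noteq> {}" unfolding B_def by blast
    fix u v assume "u \<in> B" "v \<in> B"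
    then obtain d g d' g' where u: "u = (\<lambda>x\<in>carrier X. g (d x))" "P d g"
      and v: "v = (\<lambda>x\<in>carrier X. g' (d' x))" "P d' g'"
      unfolding B_def by blast
    have "d \<in> \<D>" "d' \<in> \<D>" using PD u(2) v(2) by blast+
    then obtain c where c: "c \<in> \<D>" "d \<sqsubseteq>\<^bsub>fun_space X X\<^esub> c" "d' \<sqsubseteq>\<^bsub>fun_space X X\<^esub> c"
      using directed_inD(3)[OF \<D>(1)] by blast
    \<comment> \<open>The values of both given maps on the fibre of \<open>c\<close> over
      \<open>a\<close>. A new approximant on the image of \<open>c\<close> that dominates them at
      \<open>a\<close> yields a map above both \<open>u\<close> and \<open>v\<close>. The set is
      finite because both maps have finite image.\<close>
    let ?S = "\<lambda>a. (\<lambda>x. g (d x)) ` {x \<in> carrier X. c x = a} \<union> (\<lambda>x. g' (d' x)) ` {x \<in> carrier X. c x = a}"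
    have fin: "finite (?S a)" for a
    proof -
      have "?S a \<subseteq> g ` d ` carrier X \<union> g' ` d' ` carrier X" by blast
      moreover have "finite (g ` d ` carrier X \<union> g' ` d' ` carrier X)"
        using deflationD(3)[OF \<D>(2)] \<open>d \<in> \<D>\<close> \<open>d' \<in> \<D>\<close> by blast
      ultimately show ?thesis by (rule finite_subset)
    qed
    \<comment> \<open>On the fibre over \<open>a = c x\<close> one has
      \<open>e x \<sqsubseteq> c x\<close>, so being way below \<open>f (e x)\<close> implies being
      way below \<open>f a\<close>.\<close>
    have wb: "way_below E (q (e x)) (f (c x))"
      if "P e q" "e \<sqsubseteq>\<^bsub>fun_space X X\<^esub> c" "x \<in> carrier X" for e q x
    proof -
      have "e x \<sqsubseteq>\<^bsub>X\<^esub> c x" using that(2,3) unfolding fun_space_le by blast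
      then have "f (e x) \<sqsubseteq>\<^bsub>E\<^esub> f (c x)"
        using fm dc(1) PD[OF that(1)] c(1) that(3) by blast
      then show ?thesis
        using way_below_le_trans[OF poE Pwb(1)[OF that(1,3)]] fc[OF dc(1)[OF c(1) that(3)]] by blast
    qed
    have S_wb: "way_below E e (f a)" if "e \<in> ?S a" for a e
      using that wb[OF u(2) c(2)] wb[OF v(2) c(3)] by blast
    have "\<exists>q. P c q \<and> (\<forall>a\<in>c ` carrier X. \<forall>e\<in>?S a. e \<sqsubseteq>\<^bsub>E\<^esub> q a)"
      by (rule ex[OF c(1) fin]) (rule S_wb)
    then obtain q where q: "P c q"
      "\<forall>a\<in>c ` carrier X. \<forall>e\<in>?S a. e \<sqsubseteq>\<^bsub>E\<^esub> q a" by (elim exE conjE)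
    have "g (d x) \<sqsubseteq>\<^bsub>E\<^esub> q (c x)" "g' (d' x) \<sqsubseteq>\<^bsub>E\<^esub> q (c x)" if "x \<in> carrier X" for x
      by (rule bspec[OF bspec[OF q(2)]]; use that in blast)+
    then have "u \<sqsubseteq>\<^bsub>fun_space X E\<^esub> (\<lambda>x\<in>carrier X. q (c x))" "v \<sqsubseteq>\<^bsub>fun_space X E\<^esub> (\<lambda>x\<in>carrier X. q (c x))"
      unfolding u(1) v(1) fun_space_le by simp_all
    then show "\<exists>z\<in>B. u \<sqsubseteq>\<^bsub>fun_space X E\<^esub> z \<and> v \<sqsubseteq>\<^bsub>fun_space X E\<^esub> z"
      using BI[OF q(1)] by blast
  qed
  moreover have "is_lub (fun_space X E) f B"
  proof (rule is_lubI[OF sub f])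
    show "b \<sqsubseteq>\<^bsub>fun_space X E\<^esub> f" if "b \<in> B" for b
      by (rule way_below_le[OF fun_space_po[OF poE] B_wb[OF that]])
    fix u assume u: "u \<in> carrier (fun_space X E)" "\<And>b. b \<in> B \<Longrightarrow> b \<sqsubseteq>\<^bsub>fun_space X E\<^esub> u"
    have "f x \<sqsubseteq>\<^bsub>E\<^esub> u x" if x: "x \<in> carrier X" for x
    proof -
      note ux = fun_spaceD(3)[OF u(1) x]
      \<comment> \<open>Continuity of \<open>E\<close> reduces this to elements \<open>e\<close> way
        below \<open>f (d x)\<close>; each of them lies below the value at \<open>x\<close> of some
        member of \<open>B\<close>.\<close>
      have fd: "f (d x) \<sqsubseteq>\<^bsub>E\<^esub> u x" if d: "d \<in> \<D>" for d
      proof -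
        note fdx = fc[OF dc(1)[OF d x]]
        show ?thesis
        proof (rule is_lub_least[OF continuous_dcpoD(3)[OF E fdx] directed_inD(1)[OF continuous_dcpoD(2)[OF E fdx]] ux])
          fix e assume e: "e \<in> {y. way_below E y (f (d x))}"
          \<comment> \<open>The prescribed set is \<open>{e}\<close> at the point \<open>d x\<close>
            and empty at every other point of the image.\<close>
          have "\<exists>g. P d g \<and> (\<forall>a\<in>d ` carrier X. \<forall>e'\<in>{e' \<in> {e}. a = d x}. e' \<sqsubseteq>\<^bsub>E\<^esub> g a)"
            by (rule ex[OF d]) (use e in auto)
          then obtain g where
            g: "P d g" "\<forall>a\<in>d ` carrier X. \<forall>e'\<in>{e' \<in> {e}. a = d x}. e' \<sqsubseteq>\<^bsub>E\<^esub> g a"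
            by (elim exE conjE)
          have "(\<lambda>x\<in>carrier X. g (d x)) \<sqsubseteq>\<^bsub>fun_space X E\<^esub> u" by (rule u(2)[OF BI[OF g(1)]])
          then have "g (d x) \<sqsubseteq>\<^bsub>E\<^esub> u x" using x unfolding fun_space_le by simp
          moreover have "e \<sqsubseteq>\<^bsub>E\<^esub> g (d x)" using g(2) x by blast
          ultimately show "e \<sqsubseteq>\<^bsub>E\<^esub> u x"
            using po_trans[OF poE, of e "g (d x)" "u x"] ux Pwb(2)[OF g(1) x] e
              way_below_carrier[of E e] by blast
        qed
      qed
      \<comment> \<open>The deflations have pointwise supremum the identity, so Scott continuity
        makes \<open>f x\<close> the supremum of the \<open>f (d x)\<close>.\<close>
      have lub: "is_lub X x ((\<lambda>d. d x) ` \<D>)"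
        using fun_space_lubD[OF X dX \<D>(1,3) x] x by simp
      note dir = fun_space_directed_eval[OF \<D>(1) x]
      note flub = scott_continuousD(3)[OF fun_spaceD(1)[OF f] dir lub]
      show ?thesis
      proof (rule is_lub_least[OF flub _ ux])
        show "f ` (\<lambda>d. d x) ` \<D> \<subseteq> carrier E" using fc dc(1)[OF _ x] by blast
        show "y \<sqsubseteq>\<^bsub>E\<^esub> u x" if "y \<in> f ` (\<lambda>d. d x) ` \<D>" for y using that fd by blast
      qed
    qed
    then show "f \<sqsubseteq>\<^bsub>fun_space X E\<^esub> u" by (simp add: fun_space_le)
  qed
  ultimately show "\<exists>B. directed_in (fun_space X E) B \<and> is_lub (fun_space X E) f B \<and>
      (\<forall>b\<in>B. way_below (fun_space X E) b f)" using B_wb by blast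
qed

section \<open>The test domain\<close>

lemma algebraic_dcpoD:
  assumes "algebraic_dcpo L"
  shows "dcpo L" "x \<in> carrier L \<Longrightarrow> directed_in L {k. compact_in L k \<and> k \<sqsubseteq>\<^bsub>L\<^esub> x}"
    "x \<in> carrier L \<Longrightarrow> is_lub L x {k. compact_in L k \<and> k \<sqsubseteq>\<^bsub>L\<^esub> x}"
  using assms by (auto simp: algebraic_dcpo_def)

section \<open>Binary products and finite posets\<close>

lemma prod_order_simps [simp]:
  "carrier (prod_order L M) = carrier L \<times> carrier M"
  "(p \<sqsubseteq>\<^bsub>prod_order L M\<^esub> q) = (fst p \<sqsubseteq>\<^bsub>L\<^esub> fst q \<and> snd p \<sqsubseteq>\<^bsub>M\<^esub> snd q)"
  by (auto simp: prod_order_def split: prod.split)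

lemma prod_order_po:
  assumes L: "partial_order L" and M: "partial_order M"
  shows "partial_order (prod_order L M)"
proof (rule partial_orderI)
  show "eq (prod_order L M) = (=)" by (simp add: prod_order_def)
qed (auto intro: po_refl[OF L] po_refl[OF M] po_trans[OF L] po_trans[OF M] po_antisym[OF L] po_antisym[OF M])

lemma prod_order_directed:
  assumes "directed_in (prod_order L M) D"
  shows "directed_in L (fst ` D)" "directed_in M (snd ` D)"
  using directed_inD(1)[OF assms] by (auto intro!: directed_in_image[OF assms])

text \<open>From left to right, an upper bound \<open>u\<close> in one coordinate is completed to a
  pair with the other coordinate of \<open>p\<close> and then compared with
  \<open>p\<close>.\<close>

lemma prod_order_lub:
  assumes D: "directed_in (prod_order L M) D"
  shows "is_lub (prod_order L M) p D \<longleftrightarrow> is_lub L (fst p) (fst ` D) \<and> is_lub M (snd p) (snd ` D)"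
proof
  note Dc = directed_inD(1)[OF D]
  assume lub: "is_lub (prod_order L M) p D"
  have p: "fst p \<in> carrier L" "snd p \<in> carrier M" using is_lub_carrier[OF lub] by auto
  have up: "fst x \<sqsubseteq>\<^bsub>L\<^esub> fst p" "snd x \<sqsubseteq>\<^bsub>M\<^esub> snd p" if "x \<in> D" for x
    using is_lub_upper[OF lub Dc that] by auto
  show "is_lub L (fst p) (fst ` D) \<and> is_lub M (snd p) (snd ` D)"
  proof
    show "is_lub L (fst p) (fst ` D)"
    proof (rule is_lubI)
      fix u assume "u \<in> carrier L" "\<And>x. x \<in> fst ` D \<Longrightarrow> x \<sqsubseteq>\<^bsub>L\<^esub> u"
      then show "fst p \<sqsubseteq>\<^bsub>L\<^esub> u" using is_lub_least[OF lub Dc, of "(u, snd p)"] p up by auto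
    qed (use Dc p up in auto)
    show "is_lub M (snd p) (snd ` D)"
    proof (rule is_lubI)
      fix u assume "u \<in> carrier M" "\<And>x. x \<in> snd ` D \<Longrightarrow> x \<sqsubseteq>\<^bsub>M\<^esub> u"
      then show "snd p \<sqsubseteq>\<^bsub>M\<^esub> u" using is_lub_least[OF lub Dc, of "(fst p, u)"] p up by auto
    qed (use Dc p up in auto)
  qed
next
  note Dc = directed_inD(1)[OF prod_order_directed(1)[OF D]] directed_inD(1)[OF prod_order_directed(2)[OF D]]
  assume lub: "is_lub L (fst p) (fst ` D) \<and> is_lub M (snd p) (snd ` D)"
  show "is_lub (prod_order L M) p D"
  proof (rule is_lubI)
    show "D \<subseteq> carrier (prod_order L M)" by (rule directed_inD(1)[OF D])
    show "p \<in> carrier (prod_order L M)" using lub is_lub_carrier[of L] is_lub_carrier[of M]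
      by (auto simp: mem_Times_iff)
    show "x \<sqsubseteq>\<^bsub>prod_order L M\<^esub> p" if "x \<in> D" for x
      using is_lub_upper[OF conjunct1[OF lub] Dc(1)] is_lub_upper[OF conjunct2[OF lub] Dc(2)] that
      by simp
    show "p \<sqsubseteq>\<^bsub>prod_order L M\<^esub> u" if "u \<in> carrier (prod_order L M)"
      "\<And>x. x \<in> D \<Longrightarrow> x \<sqsubseteq>\<^bsub>prod_order L M\<^esub> u" for u
      using is_lub_least[OF conjunct1[OF lub] Dc(1), of "fst u"]
        is_lub_least[OF conjunct2[OF lub] Dc(2), of "snd u"] that
      by (force simp: mem_Times_iff)
  qed
qed

lemma prod_order_dcpo:
  assumes L: "dcpo L" and M: "dcpo M"
  shows "dcpo (prod_order L M)"
  unfolding dcpo_def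
proof (intro conjI allI impI)
  show "partial_order (prod_order L M)" using L M by (intro prod_order_po dcpo_po)
  fix D assume D: "directed_in (prod_order L M) D"
  obtain a b where "is_lub L a (fst ` D)" "is_lub M b (snd ` D)"
    using dcpo_lub[OF L prod_order_directed(1)[OF D]] dcpo_lub[OF M prod_order_directed(2)[OF D]] by blast
  then have "is_lub (prod_order L M) (a, b) D" by (simp add: prod_order_lub[OF D])
  then show "\<exists>s. is_lub (prod_order L M) s D" by blast
qed

text \<open>Compactness in each coordinate gives two members of \<open>D\<close>, one for each;
  directedness of \<open>D\<close> merges them into a single member above
  \<open>(a, b)\<close>.\<close>

lemma compact_in_prod_order:
  assumes L: "partial_order L" and M: "partial_order M" and "compact_in L a" "compact_in M b"
  shows "compact_in (prod_order L M) (a, b)"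
  unfolding compact_in_def
proof (rule way_belowI)
  have c: "a \<in> carrier L" "b \<in> carrier M"
    using assms(3,4) way_below_carrier[of L] way_below_carrier[of M] unfolding compact_in_def by blast+
  then show "(a, b) \<in> carrier (prod_order L M)" "(a, b) \<in> carrier (prod_order L M)" by simp_all
  fix D s assume D: "directed_in (prod_order L M) D" "is_lub (prod_order L M) s D"
    and le: "(a, b) \<sqsubseteq>\<^bsub>prod_order L M\<^esub> s"
  have lub: "is_lub L (fst s) (fst ` D)" "is_lub M (snd s) (snd ` D)"
    using D(2) unfolding prod_order_lub[OF D(1)] by auto
  obtain p q where p: "p \<in> D" "a \<sqsubseteq>\<^bsub>L\<^esub> fst p" and q: "q \<in> D" "b \<sqsubseteq>\<^bsub>M\<^esub> snd q"
    using way_belowD[OF assms(3)[unfolded compact_in_def] prod_order_directed(1)[OF D(1)] lub(1)]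
      way_belowD[OF assms(4)[unfolded compact_in_def] prod_order_directed(2)[OF D(1)] lub(2)] le
    by auto
  obtain z where z: "z \<in> D" "p \<sqsubseteq>\<^bsub>prod_order L M\<^esub> z" "q \<sqsubseteq>\<^bsub>prod_order L M\<^esub> z"
    using directed_inD(3)[OF D(1) p(1) q(1)] by blast
  have "fst p \<in> carrier L" "fst z \<in> carrier L" "snd q \<in> carrier M" "snd z \<in> carrier M"
    using directed_inD(1)[OF D(1)] p(1) q(1) z(1) by auto
  then have "a \<sqsubseteq>\<^bsub>L\<^esub> fst z" "b \<sqsubseteq>\<^bsub>M\<^esub> snd z"
    using po_trans[OF L p(2), of "fst z"] po_trans[OF M q(2), of "snd z"] z(2,3) c by auto
  then show "\<exists>d\<in>D. (a, b) \<sqsubseteq>\<^bsub>prod_order L M\<^esub> d" using z(1) by auto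
qed

lemma prod_order_algebraic:
  assumes L: "algebraic_dcpo L" and M: "algebraic_dcpo M"
  shows "algebraic_dcpo (prod_order L M)"
proof (rule algebraic_dcpoI)
  note dL = algebraic_dcpoD(1)[OF L] and dM = algebraic_dcpoD(1)[OF M]
  show "dcpo (prod_order L M)" by (rule prod_order_dcpo[OF dL dM])
  fix x assume "x \<in> carrier (prod_order L M)"
  then have x: "fst x \<in> carrier L" "snd x \<in> carrier M" by auto
  let ?A = "{k. compact_in L k \<and> k \<sqsubseteq>\<^bsub>L\<^esub> fst x}" and ?B = "{k. compact_in M k \<and> k \<sqsubseteq>\<^bsub>M\<^esub> snd x}"
  note A = algebraic_dcpoD(2,3)[OF L x(1)] and B = algebraic_dcpoD(2,3)[OF M x(2)]
  have dir: "directed_in (prod_order L M) (?A \<times> ?B)"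
  proof (rule directed_inI)
    show "?A \<times> ?B \<subseteq> carrier (prod_order L M)"
      using directed_inD(1)[OF A(1)] directed_inD(1)[OF B(1)] by auto
    show "?A \<times> ?B \<noteq> {}" using directed_inD(2)[OF A(1)] directed_inD(2)[OF B(1)] by blast
    fix p q assume pq: "p \<in> ?A \<times> ?B" "q \<in> ?A \<times> ?B"
    obtain a where a: "a \<in> ?A" "fst p \<sqsubseteq>\<^bsub>L\<^esub> a" "fst q \<sqsubseteq>\<^bsub>L\<^esub> a"
      using directed_inD(3)[OF A(1), of "fst p" "fst q"] pq by (auto simp: mem_Times_iff)
    obtain b where b: "b \<in> ?B" "snd p \<sqsubseteq>\<^bsub>M\<^esub> b" "snd q \<sqsubseteq>\<^bsub>M\<^esub> b"
      using directed_inD(3)[OF B(1), of "snd p" "snd q"] pq by (auto simp: mem_Times_iff)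
    show "\<exists>z\<in>?A \<times> ?B. p \<sqsubseteq>\<^bsub>prod_order L M\<^esub> z \<and> q \<sqsubseteq>\<^bsub>prod_order L M\<^esub> z"
      by (rule bexI[of _ "(a, b)"]) (use a b in auto)
  qed
  have ne: "?A \<noteq> {}" "?B \<noteq> {}" using directed_inD(2)[OF A(1)] directed_inD(2)[OF B(1)] by blast+
  have "is_lub (prod_order L M) x (?A \<times> ?B)"
    \<comment> \<open>The projections of a product set are its factors only if the other factor is
      nonempty, hence the rewriting with \<open>ne\<close>.\<close>
    unfolding prod_order_lub[OF dir] fst_image_times snd_image_times if_not_P[OF ne(1)] if_not_P[OF ne(2)]
    using A(2) B(2) by blast
  moreover have "compact_in (prod_order L M) p" if "p \<in> ?A \<times> ?B" for p
    using that compact_in_prod_order[OF dcpo_po[OF dL] dcpo_po[OF dM]] by auto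
  ultimately show "\<exists>B. directed_in (prod_order L M) B \<and> is_lub (prod_order L M) x B \<and>
      (\<forall>b\<in>B. compact_in (prod_order L M) b)"
    using dir by blast
qed

text \<open>A directed subset of a finite poset contains its greatest element. Therefore every
  element is compact, and the singleton \<open>{x}\<close> is a directed family of compact elements
  with supremum \<open>x\<close>.\<close>

lemma finite_poset_algebraic:
  assumes L: "partial_order L" and fin: "finite (carrier L)"
  shows "algebraic_dcpo L"
proof -
  have max: "\<exists>m\<in>D. \<forall>x\<in>D. x \<sqsubseteq>\<^bsub>L\<^esub> m" if D: "directed_in L D" for D
    using directed_in_finite_bound[OF L D finite_subset[OF directed_inD(1)[OF D] fin] subset_refl] .
  have "is_lub L m D" if "directed_in L D" "m \<in> D" "\<forall>x\<in>D. x \<sqsubseteq>\<^bsub>L\<^esub> m" for D m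
    by (rule is_lubI) (use directed_inD(1)[OF that(1)] that in auto)
  then have dcpo: "dcpo L" using L max unfolding dcpo_def by blast
  have compact: "compact_in L x" if x: "x \<in> carrier L" for x
    unfolding compact_in_def
  proof (rule way_belowI[OF x x])
    fix D s assume D: "directed_in L D" "is_lub L s D" "x \<sqsubseteq>\<^bsub>L\<^esub> s"
    note Dc = directed_inD(1)[OF D(1)]
    obtain m where m: "m \<in> D" "\<forall>x\<in>D. x \<sqsubseteq>\<^bsub>L\<^esub> m" using max[OF D(1)] by blast
    then have "s \<sqsubseteq>\<^bsub>L\<^esub> m" using is_lub_least[OF D(2) Dc, of m] Dc by blast
    then show "\<exists>d\<in>D. x \<sqsubseteq>\<^bsub>L\<^esub> d"
      using po_trans[OF L D(3), of m] x is_lub_carrier[OF D(2)] m(1) Dc by blast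
  qed
  show ?thesis
    by (rule algebraic_dcpoI[OF dcpo]) (use is_lub_singleton[OF L] compact in blast)
qed

lemma V_order_algebraic: "algebraic_dcpo V_order"
proof (rule finite_poset_algebraic)
  show "partial_order V_order" by (rule partial_orderI) (auto simp: V_order_def)
  have "(UNIV :: vee set) = {VLeft, VRight, VTop}" by (auto intro: vee.exhaust)
  then have "finite (UNIV :: vee set)" by (metis finite.emptyI finite_insert)
  then show "finite (carrier V_order)" by (simp add: V_order_def)
qed

section \<open>The order E_X\<close>

lemma E_order_carrier:
  "p \<in> carrier (E_order X) \<longleftrightarrow>
    (snd p = 0 \<and> (fst p = {} \<or> directed_in X (fst p))) \<or> (snd p = 1 \<and> fst p \<subseteq> carrier X)"
  by (cases p) (auto simp: E_order_def)

lemma E_order_le: "p \<sqsubseteq>\<^bsub>E_order X\<^esub> q \<longleftrightarrow> fst p \<subseteq> fst q \<and> snd p \<le> snd q"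
  by (simp add: E_order_def split: prod.split)

lemma E_order_po: "partial_order (E_order X)"
  by (rule partial_orderI) (auto simp: E_order_le E_order_def)

text \<open>If all members of \<open>D\<close> have flag 0, their union is again directed or empty,
  because any two of its points lie in the set component of one member. Once a member has flag 1,
  arbitrary subsets are allowed and nothing is left to check about the union.\<close>

lemma E_order_lub:
  assumes D: "directed_in (E_order X) D"
  shows "is_lub (E_order X) (\<Union>(fst ` D), if \<exists>p\<in>D. snd p = 1 then 1 else 0) D" (is "is_lub _ ?s D")
proof (rule is_lubI)
  show sub: "D \<subseteq> carrier (E_order X)" by (rule directed_inD(1)[OF D])
  have dir: "\<exists>z\<in>D. fst x \<subseteq> fst z \<and> fst y \<subseteq> fst z" if "x \<in> D" "y \<in> D" for x y
    using directed_inD(3)[OF D that] by (auto simp: E_order_le)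
  have sub_X: "fst x \<subseteq> carrier X" if "x \<in> D" for x
    using sub that directed_inD(1)[of X "fst x"] unfolding subset_iff E_order_carrier by blast
  have snd01: "snd x = 0 \<or> snd x = 1" if "x \<in> D" for x
    using sub that unfolding subset_iff E_order_carrier by blast
  show "?s \<in> carrier (E_order X)"
  \<comment> \<open>Only flag 0 with a nonempty union requires proving directedness.\<close>
  proof (cases "(\<exists>p\<in>D. snd p = 1) \<or> \<Union>(fst ` D) = {}")
    case False
    then have dirs: "fst x = {} \<or> directed_in X (fst x)" if "x \<in> D" for x
      using sub that unfolding subset_iff E_order_carrier by blast
    have "directed_in X (\<Union>(fst ` D))"
    proof (rule directed_inI)
      fix u v assume "u \<in> \<Union>(fst ` D)" "v \<in> \<Union>(fst ` D)"
      then obtain x y where "x \<in> D" "y \<in> D" "u \<in> fst x" "v \<in> fst y" by blast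
      with dir obtain z where z: "z \<in> D" "u \<in> fst z" "v \<in> fst z" by blast
      then have "directed_in X (fst z)" using dirs by blast
      from directed_inD(3)[OF this z(2,3)] z(1)
      show "\<exists>w\<in>\<Union>(fst ` D). u \<sqsubseteq>\<^bsub>X\<^esub> w \<and> v \<sqsubseteq>\<^bsub>X\<^esub> w" by blast
    qed (use sub_X False in auto)
    then show ?thesis using False by (simp add: E_order_carrier)
  qed (use sub_X in \<open>auto simp: E_order_carrier\<close>)
  show "x \<sqsubseteq>\<^bsub>E_order X\<^esub> ?s" if "x \<in> D" for x
    using that snd01[OF that] by (auto simp: E_order_le)
  show "?s \<sqsubseteq>\<^bsub>E_order X\<^esub> u" if "\<And>x. x \<in> D \<Longrightarrow> x \<sqsubseteq>\<^bsub>E_order X\<^esub> u" for u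
    using that by (force simp: E_order_le)
qed

lemma E_order_dcpo: "dcpo (E_order X)"
  unfolding dcpo_def using E_order_po E_order_lub by blast

text \<open>Each point of the finite set \<open>fst p\<close> already lies in the set component of
  some member of \<open>D\<close>, and the flag of the supremum is attained in \<open>D\<close>. A
  common bound of these finitely many members dominates \<open>p\<close>.\<close>

lemma compact_in_E_order:
  assumes "p \<in> carrier (E_order X)" "finite (fst p)"
  shows "compact_in (E_order X) p"
  unfolding compact_in_def
proof (rule way_belowI[OF assms(1,1)])
  fix D s assume D: "directed_in (E_order X) D" "is_lub (E_order X) s D" "p \<sqsubseteq>\<^bsub>E_order X\<^esub> s"
  have s: "s = (\<Union>(fst ` D), if \<exists>p\<in>D. snd p = 1 then 1 else 0)"
    by (rule is_lub_same[OF E_order_po D(2) E_order_lub[OF D(1)]])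
  have "fst p \<subseteq> \<Union>(fst ` D)" using D(3) s by (simp add: E_order_le)
  then have "\<forall>x\<in>fst p. \<exists>d. d \<in> D \<and> x \<in> fst d" by blast
  from bchoice[OF this] obtain k where k: "\<forall>x\<in>fst p. k x \<in> D \<and> x \<in> fst (k x)"
    by (elim exE)
  obtain e where e: "e \<in> D" "snd p \<le> snd e"
  proof (cases "\<exists>p\<in>D. snd p = 1")
    case True
    then have "snd s = 1" using s by simp
    then have "snd p \<le> 1" using D(3) by (simp add: E_order_le)
    with True that show ?thesis by auto
  next
    case False
    then have "snd s = 0" using s by simp
    then have "snd p = 0" using D(3) by (simp add: E_order_le)
    with directed_inD(2)[OF D(1)] that show ?thesis by auto
  qed
  obtain z where z: "z \<in> D" "\<forall>x\<in>insert e (k ` fst p). x \<sqsubseteq>\<^bsub>E_order X\<^esub> z"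
    using directed_in_finite_bound[OF E_order_po D(1), of "insert e (k ` fst p)"] assms(2) k e(1)
    by blast
  have "fst p \<subseteq> fst z" using z(2) k by (fastforce simp: E_order_le)
  moreover have "snd p \<le> snd z" using z(2) e(2) by (auto simp: E_order_le)
  ultimately show "\<exists>d\<in>D. p \<sqsubseteq>\<^bsub>E_order X\<^esub> d" using z(1) by (auto simp: E_order_le)
qed

text \<open>A finite subset \<open>F\<close> of a directed set need not be directed, but it becomes
  so after adding an upper bound of \<open>F\<close> taken from that directed set. Hence the compact
  elements with the same flag and a finite set component exhaust every element.\<close>

lemma E_order_algebraic:
  assumes X: "partial_order X"
  shows "algebraic_dcpo (E_order X)"
proof (rule algebraic_dcpoI[OF E_order_dcpo])
  fix p assume p: "p \<in> carrier (E_order X)"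
  let ?B = "{q \<in> carrier (E_order X). finite (fst q) \<and> snd q = snd p \<and> fst q \<subseteq> fst p}"
  have sub: "?B \<subseteq> carrier (E_order X)" by blast
  have fin_ext: "\<exists>q\<in>?B. F \<subseteq> fst q" if F: "finite F" "F \<subseteq> fst p" for F
  proof (cases "snd p = 1 \<or> fst p = {}")
    case True
    then have "(F, snd p) \<in> ?B" using p F by (auto simp: E_order_carrier)
    then show ?thesis by force
  next
    case False
    then have dir: "directed_in X (fst p)" and "snd p = 0"
      using p unfolding E_order_carrier by auto
    obtain z where z: "z \<in> fst p" "\<forall>x\<in>F. x \<sqsubseteq>\<^bsub>X\<^esub> z"
      using directed_in_finite_bound[OF X dir F] by blast
    have zX: "z \<in> carrier X" and FX: "F \<subseteq> carrier X" using z(1) F(2) directed_inD(1)[OF dir] by auto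
    have "directed_in X (insert z F)"
      using z(2) zX FX po_refl[OF X zX] by (intro directed_inI) auto
    then have "(insert z F, snd p) \<in> ?B"
      using F z(1) \<open>snd p = 0\<close> by (simp add: E_order_carrier)
    then show ?thesis by force
  qed
  have dir: "directed_in (E_order X) ?B"
  proof (rule directed_inI[OF sub])
    show "?B \<noteq> {}" using fin_ext[of "{}"] by blast
    fix q r assume "q \<in> ?B" "r \<in> ?B"
    then show "\<exists>z\<in>?B. q \<sqsubseteq>\<^bsub>E_order X\<^esub> z \<and> r \<sqsubseteq>\<^bsub>E_order X\<^esub> z"
      using fin_ext[of "fst q \<union> fst r"] by (auto simp: E_order_le)
  qed
  have "is_lub (E_order X) p ?B"
  proof (rule is_lubI[OF sub p])
    show "q \<sqsubseteq>\<^bsub>E_order X\<^esub> p" if "q \<in> ?B" for q using that by (simp add: E_order_le)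
    fix u assume u: "\<And>q. q \<in> ?B \<Longrightarrow> q \<sqsubseteq>\<^bsub>E_order X\<^esub> u"
    have "x \<in> fst u" if x: "x \<in> fst p" for x
    proof -
      obtain q where "q \<in> ?B" "x \<in> fst q" using fin_ext[of "{x}"] x by auto
      with u[of q] show ?thesis by (auto simp: E_order_le)
    qed
    moreover obtain q where "q \<in> ?B" using fin_ext[of "{}"] by blast
    with u[of q] have "snd p \<le> snd u" by (simp add: E_order_le)
    ultimately show "p \<sqsubseteq>\<^bsub>E_order X\<^esub> u" by (auto simp: E_order_le)
  qed
  moreover have "\<forall>q\<in>?B. compact_in (E_order X) q" using compact_in_E_order by blast
  ultimately show "\<exists>B. directed_in (E_order X) B \<and> is_lub (E_order X) p B \<and>
      (\<forall>b\<in>B. compact_in (E_order X) b)"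
    using dir by blast
qed

section \<open>The test domain A_X and maps into it\<close>

lemma A_order_algebraic: "partial_order X \<Longrightarrow> algebraic_dcpo (A_order X)"
  unfolding A_order_def by (intro prod_order_algebraic E_order_algebraic V_order_algebraic)

lemma A_order_carrier: "p \<in> carrier (A_order X) \<longleftrightarrow> fst p \<in> carrier (E_order X)"
  by (cases p) (simp add: A_order_def V_order_def)

lemma A_order_le: "p \<sqsubseteq>\<^bsub>A_order X\<^esub> q \<longleftrightarrow>
    fst (fst p) \<subseteq> fst (fst q) \<and> snd (fst p) \<le> snd (fst q) \<and> (snd p = snd q \<or> snd q = VTop)"
  by (auto simp: A_order_def E_order_le) (auto simp: V_order_def)

lemma A_order_cont_domain:
  assumes "partial_order X"
  shows "cont_domain (A_order X)"
proof -
  have "(({}, 0), VTop) \<in> carrier (A_order X)" by (simp add: A_order_carrier E_order_carrier)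
  then show ?thesis
    using algebraic_imp_continuous[OF A_order_algebraic[OF assms]] unfolding cont_domain_def by blast
qed

lemma A_order_lub_fst:
  assumes "directed_in (A_order X) D" "is_lub (A_order X) s D"
  shows "fst (fst s) = (\<Union>p\<in>D. fst (fst p))"
proof -
  note D = assms[unfolded A_order_def]
  have "is_lub (E_order X) (fst s) (fst ` D)" using D(2) unfolding prod_order_lub[OF D(1)] by blast
  from is_lub_same[OF E_order_po this E_order_lub[OF prod_order_directed(1)[OF D(1)]]]
  show ?thesis by simp
qed

text \<open>The conditions on \<open>U\<close> express Scott openness. Constant maps are also
  obtained from this lemma, by letting \<open>U\<close> be the carrier and giving both branches the
  same value.\<close>

lemma step_fun_space:
  assumes X: "partial_order X" and Y: "partial_order Y" and t: "t \<in> carrier Y"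
    and c: "c \<in> carrier Y" "c \<sqsubseteq>\<^bsub>Y\<^esub> t"
    and U_up: "\<And>x y. \<lbrakk>x \<in> U; x \<in> carrier X; y \<in> carrier X; x \<sqsubseteq>\<^bsub>X\<^esub> y\<rbrakk> \<Longrightarrow> y \<in> U"
    and U_open: "\<And>D s. \<lbrakk>directed_in X D; is_lub X s D; s \<in> U\<rbrakk> \<Longrightarrow> \<exists>d\<in>D. d \<in> U"
  shows "(\<lambda>x\<in>carrier X. if x \<in> U then t else c) \<in> carrier (fun_space X Y)"
proof (rule fun_space_carrierI[OF X Y])
  show "(if x \<in> U then t else c) \<in> carrier Y" for x using t c by simp
  show "(if x \<in> U then t else c) \<sqsubseteq>\<^bsub>Y\<^esub> (if y \<in> U then t else c)"
    if "x \<in> carrier X" "y \<in> carrier X" "x \<sqsubseteq>\<^bsub>X\<^esub> y" for x y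
    using U_up[OF _ that] po_refl[OF Y t] po_refl[OF Y c(1)] c(2) by auto
  fix D s u
  assume D: "directed_in X D" "is_lub X s D" and u: "u \<in> carrier Y"
    and le: "\<And>d. d \<in> D \<Longrightarrow> (if d \<in> U then t else c) \<sqsubseteq>\<^bsub>Y\<^esub> u"
  show "(if s \<in> U then t else c) \<sqsubseteq>\<^bsub>Y\<^esub> u"
  proof (cases "s \<in> U")
    case True
    then obtain d where "d \<in> D" "d \<in> U" using U_open[OF D] by blast
    then show ?thesis using le[of d] True by simp
  next
    case False
    \<comment> \<open>Whichever branch applies at \<open>d\<close>, its value is at least
      \<open>c\<close>, so \<open>u\<close> dominates \<open>c\<close>.\<close>
    obtain d where "d \<in> D" using directed_inD(2)[OF D(1)] by blast
    from le[OF this] have "c \<sqsubseteq>\<^bsub>Y\<^esub> u" using po_trans[OF Y c(2) _ c(1) t u] by (simp split: if_splits)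
    then show ?thesis using False by simp
  qed
qed

lemma A_order_fun_space_lub:
  assumes X: "partial_order X" and h: "h \<in> carrier (fun_space X (A_order X))"
    and D: "directed_in X D" "is_lub X s D"
  shows "fst (fst (h s)) = (\<Union>x\<in>D. fst (fst (h x)))"
  using A_order_lub_fst[OF scott_continuous_directed_image[OF fun_spaceD(1)[OF h] D(1)]
      scott_continuousD(3)[OF fun_spaceD(1)[OF h] D]] by auto

section \<open>Deflations from a continuous function space into A_X\<close>

lemma fun_space_continuous_imp_RB_domain:
  fixes X :: "'a gorder"
  assumes X: "cont_domain X" and cont: "continuous_dcpo (fun_space X (A_order X))"
  shows "RB_domain X"
proof -
  let ?A = "A_order X"
  let ?F = "fun_space X ?A"
  have cX: "continuous_dcpo X" using X by (simp add: cont_domain_def)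
  note dX = continuous_dcpoD(1)[OF cX]
  note poX = dcpo_po[OF dX]
  have dA: "dcpo ?A" by (rule algebraic_dcpoD(1)[OF A_order_algebraic[OF poX]])
  note poA = dcpo_po[OF dA] and poF = fun_space_po[OF dcpo_po[OF dA]]
  define W where "W x = {y. way_below X y x}" for x
  have W: "directed_in X (W x)" "is_lub X x (W x)" if "x \<in> carrier X" for x
    unfolding W_def by (rule continuous_dcpoD(2,3)[OF cX that])+
  have W_mono: "W x \<subseteq> W y" if "x \<sqsubseteq>\<^bsub>X\<^esub> y" "y \<in> carrier X" for x y
    unfolding W_def using way_below_le_trans[OF poX _ that] by blast
  have W_lub: "W s \<subseteq> (\<Union>d\<in>D. W d)" if "directed_in X D" "is_lub X s D" for D s
    using way_below_lubD[OF cX that] unfolding W_def by blast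
  \<comment> \<open>Flag 0 is essential: everything below \<open>f\<close> then also has flag 0,
    which forces its set components to be empty or directed.\<close>
  define f where "f = (\<lambda>x\<in>carrier X. ((W x, 0 :: nat), VTop))"
  have f: "f \<in> carrier ?F"
    unfolding f_def
  proof (rule fun_space_carrierI[OF poX poA])
    show "((W x, 0), VTop) \<in> carrier ?A" if "x \<in> carrier X" for x
      using W(1)[OF that] by (simp add: A_order_carrier E_order_carrier)
    show "((W x, 0), VTop) \<sqsubseteq>\<^bsub>?A\<^esub> ((W y, 0), VTop)"
      if "x \<in> carrier X" "y \<in> carrier X" "x \<sqsubseteq>\<^bsub>X\<^esub> y" for x y
      using W_mono[OF that(3,2)] by (simp add: A_order_le)
    fix D s u assume D: "directed_in X D" "is_lub X s D"
      and u: "\<And>d. d \<in> D \<Longrightarrow> ((W d, 0), VTop) \<sqsubseteq>\<^bsub>?A\<^esub> u"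
    have "W s \<subseteq> fst (fst u)" using W_lub[OF D] u unfolding A_order_le by fastforce
    moreover have "snd u = VTop"
      using directed_inD(2)[OF D(1)] u unfolding A_order_le by fastforce
    ultimately show "((W s, 0), VTop) \<sqsubseteq>\<^bsub>?A\<^esub> u" by (simp add: A_order_le)
  qed
  define H where "H = {h. way_below ?F h f}"
  have H: "directed_in ?F H" "is_lub ?F f H"
    unfolding H_def by (rule continuous_dcpoD(2,3)[OF cont f])+
  have Hc: "h \<in> carrier ?F" if "h \<in> H" for h using directed_inD(1)[OF H(1)] that by blast
  define G where "G h x = fst (fst (h x))" for h :: "'a \<Rightarrow> ('a set \<times> nat) \<times> vee" and x
  have G_mono: "G h x \<subseteq> G k x" if "h \<sqsubseteq>\<^bsub>?F\<^esub> k" "x \<in> carrier X" for h k x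
    using that unfolding fun_space_le A_order_le G_def by blast
  have G_incr: "G h x \<subseteq> G h y" if "h \<in> H" "x \<in> carrier X" "y \<in> carrier X" "x \<sqsubseteq>\<^bsub>X\<^esub> y" for h x y
    using scott_continuousD(2)[OF fun_spaceD(1)[OF Hc[OF that(1)]] that(2-4)]
    unfolding A_order_le G_def by blast
  have G_lub: "G h s = (\<Union>x\<in>D. G h x)" if "h \<in> H" "directed_in X D" "is_lub X s D" for h D s
    unfolding G_def by (rule A_order_fun_space_lub[OF poX Hc[OF that(1)] that(2,3)])
  \<comment> \<open>Suprema of maps are pointwise, and the set component of a supremum in A_X is a
    union.\<close>
  have G_sup: "(\<Union>h\<in>H. G h x) = W x" if x: "x \<in> carrier X" for x
    using A_order_lub_fst[OF fun_space_directed_eval[OF H(1) x] fun_space_lubD[OF poX dA H x]] x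
    unfolding G_def f_def by simp
  have G_dir: "G h x = {} \<or> directed_in X (G h x)" if h: "h \<in> H" and x: "x \<in> carrier X" for h x
  proof -
    have "h x \<sqsubseteq>\<^bsub>?A\<^esub> f x"
      using is_lub_upper[OF H(2) directed_inD(1)[OF H(1)] h] x unfolding fun_space_le by blast
    then have "snd (fst (h x)) = 0" using x by (simp add: A_order_le f_def)
    moreover have "fst (h x) \<in> carrier (E_order X)"
      using fun_spaceD(3)[OF Hc[OF h] x] by (simp add: A_order_carrier)
    ultimately show ?thesis unfolding E_order_carrier G_def by simp
  qed
  \<comment> \<open>Flag 1 puts \<open>T\<close> above \<open>f\<close> and admits arbitrary subsets
    of the carrier, so \<open>T\<close> can be approximated through finite sets even if the carrier
    is not directed.\<close>
  define T where "T = (\<lambda>x\<in>carrier X. ((carrier X, 1 :: nat), VTop))"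
  have T: "T \<in> carrier ?F" and f_T: "f \<sqsubseteq>\<^bsub>?F\<^esub> T"
  proof -
    have "(\<lambda>x\<in>carrier X. if x \<in> carrier X then ((carrier X, 1), VTop) else ((carrier X, 1), VTop)) \<in> carrier ?F"
      by (rule step_fun_space[OF poX poA])
        (auto simp: A_order_carrier E_order_carrier A_order_le directed_in_def)
    then show "T \<in> carrier ?F" unfolding T_def by (simp cong: restrict_cong)
    show "f \<sqsubseteq>\<^bsub>?F\<^esub> T"
      unfolding fun_space_le f_def T_def using directed_inD(1)[OF W(1)] by (simp add: A_order_le)
  qed
  \<comment> \<open>\<open>h\<close> is way below \<open>f\<close>, and \<open>f\<close> is below
    the directed supremum \<open>T\<close> of the constants \<open>C S\<close>, so \<open>h\<close>
    is below one of them.\<close>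
  have G_finite: "\<exists>S. finite S \<and> (\<forall>x\<in>carrier X. G h x \<subseteq> S)" if h: "h \<in> H" for h
  proof -
    define C where "C S = (\<lambda>x\<in>carrier X. ((S, 1 :: nat), VTop))" for S :: "'a set"
    let ?K = "C ` {S. finite S \<and> S \<subseteq> carrier X}"
    have C: "C S \<in> carrier ?F" if "S \<subseteq> carrier X" for S
    proof -
      have "(\<lambda>x\<in>carrier X. if x \<in> carrier X then ((S, 1), VTop) else ((S, 1), VTop)) \<in> carrier ?F"
        by (rule step_fun_space[OF poX poA])
          (use that in \<open>auto simp: A_order_carrier E_order_carrier A_order_le directed_in_def\<close>)
      then show ?thesis unfolding C_def by (simp cong: restrict_cong)
    qed
    have sub: "?K \<subseteq> carrier ?F" using C by blast
    have dir: "directed_in ?F ?K"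
    proof (rule directed_inI[OF sub])
      show "?K \<noteq> {}" by blast
      fix u v assume "u \<in> ?K" "v \<in> ?K"
      then obtain S S' where S: "u = C S" "finite S" "S \<subseteq> carrier X" "v = C S'" "finite S'" "S' \<subseteq> carrier X"
        by blast
      show "\<exists>z\<in>?K. u \<sqsubseteq>\<^bsub>?F\<^esub> z \<and> v \<sqsubseteq>\<^bsub>?F\<^esub> z"
        by (rule bexI[of _ "C (S \<union> S')"]) (use S in \<open>auto simp: fun_space_le C_def A_order_le\<close>)
    qed
    have "is_lub ?F T ?K"
    proof (rule is_lubI[OF sub T])
      show "k \<sqsubseteq>\<^bsub>?F\<^esub> T" if "k \<in> ?K" for k
        using that by (auto simp: fun_space_le C_def T_def A_order_le)
      fix u assume "\<And>k. k \<in> ?K \<Longrightarrow> k \<sqsubseteq>\<^bsub>?F\<^esub> u"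
      then have u: "C S \<sqsubseteq>\<^bsub>?F\<^esub> u" if "finite S" "S \<subseteq> carrier X" for S using that by blast
      have ux: "((S, 1), VTop) \<sqsubseteq>\<^bsub>?A\<^esub> u x"
        if "finite S" "S \<subseteq> carrier X" "x \<in> carrier X" for S x
        using u[OF that(1,2)] that(3) by (simp add: fun_space_le C_def)
      have "((carrier X, 1), VTop) \<sqsubseteq>\<^bsub>?A\<^esub> u x" if x: "x \<in> carrier X" for x
      proof -
        have "y \<in> fst (fst (u x))" if "y \<in> carrier X" for y
          using ux[of "{y}" x] that x by (simp add: A_order_le)
        moreover have "1 \<le> snd (fst (u x))" "snd (u x) = VTop"
          using ux[of "{}" x] x by (auto simp: A_order_le)
        ultimately show ?thesis by (auto simp: A_order_le)
      qed
      then show "T \<sqsubseteq>\<^bsub>?F\<^esub> u" by (simp add: fun_space_le T_def)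
    qed
    then obtain S where S: "finite S" "h \<sqsubseteq>\<^bsub>?F\<^esub> C S"
      using way_belowD[OF _ dir _ f_T, of h] h unfolding H_def by blast
    then have "G h x \<subseteq> S" if "x \<in> carrier X" for x
      using that by (simp add: fun_space_le C_def A_order_le G_def)
    with S(1) show ?thesis by blast
  qed
  \<comment> \<open>The points where \<open>h\<close> has a nonempty set component. For
    \<open>h\<close> in \<open>H\<close> this set is Scott open, by \<open>G_incr\<close> and
    \<open>G_lub\<close>.\<close>
  define U where "U h = {x \<in> carrier X. G h x \<noteq> {}}" for h
  have step: "\<exists>k\<in>H. \<forall>x\<in>carrier X - U k. snd (h x) = v"
    if h: "h \<in> H" and v: "v \<noteq> VTop" for h v
  proof -
    \<comment> \<open>\<open>C k\<close> agrees with \<open>T\<close> on \<open>U k\<close> and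
      differs from it elsewhere only in the V-component. As every \<open>W x\<close> is nonempty,
      the sets \<open>U k\<close> cover the carrier, so the supremum of the \<open>C k\<close> is
      \<open>T\<close>.\<close>
    define C where "C k = (\<lambda>x\<in>carrier X. if x \<in> U k then ((carrier X, 1 :: nat), VTop)
      else ((carrier X, 1), v))" for k
    have C: "C k \<in> carrier ?F" if k: "k \<in> H" for k
      unfolding C_def
    proof (rule step_fun_space[OF poX poA])
      show "y \<in> U k" if "x \<in> U k" "x \<in> carrier X" "y \<in> carrier X" "x \<sqsubseteq>\<^bsub>X\<^esub> y" for x y
        using G_incr[OF k that(2-4)] that(1,3) unfolding U_def by blast
      show "\<exists>d\<in>D. d \<in> U k" if D: "directed_in X D" "is_lub X s D" "s \<in> U k" for D s
        using G_lub[OF k D(1,2)] D(3) directed_inD(1)[OF D(1)] unfolding U_def by blast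
    qed (auto simp: A_order_carrier E_order_carrier A_order_le)
    have sub: "C ` H \<subseteq> carrier ?F" using C by blast
    have dir: "directed_in ?F (C ` H)"
    proof (rule directed_in_image[OF H(1) C])
      fix k l assume "k \<sqsubseteq>\<^bsub>?F\<^esub> l"
      then have "U k \<subseteq> U l" using G_mono unfolding U_def by blast
      then show "C k \<sqsubseteq>\<^bsub>?F\<^esub> C l" by (auto simp: fun_space_le C_def A_order_le)
    qed
    have "is_lub ?F T (C ` H)"
    proof (rule is_lubI[OF sub T])
      show "k \<sqsubseteq>\<^bsub>?F\<^esub> T" if "k \<in> C ` H" for k
        using that by (auto simp: fun_space_le C_def T_def A_order_le split: if_splits)
      fix u assume u: "\<And>k. k \<in> C ` H \<Longrightarrow> k \<sqsubseteq>\<^bsub>?F\<^esub> u"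
      have "((carrier X, 1), VTop) \<sqsubseteq>\<^bsub>?A\<^esub> u x" if x: "x \<in> carrier X" for x
      proof -
        have "W x \<noteq> {}" by (rule directed_inD(2)[OF W(1)[OF x]])
        then obtain k where k: "k \<in> H" "x \<in> U k" using G_sup[OF x] x unfolding U_def by blast
        have "C k x \<sqsubseteq>\<^bsub>?A\<^esub> u x" using u[of "C k"] k(1) x unfolding fun_space_le by blast
        then show ?thesis using k(2) x by (simp add: C_def)
      qed
      then show "T \<sqsubseteq>\<^bsub>?F\<^esub> u" by (simp add: fun_space_le T_def)
    qed
    then obtain k where k: "k \<in> H" "h \<sqsubseteq>\<^bsub>?F\<^esub> C k"
      using way_belowD[OF _ dir _ f_T, of h] h unfolding H_def by blast
    \<comment> \<open>In V only an element itself lies below a non-top \<open>v\<close>, so being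
      below \<open>C k\<close> off \<open>U k\<close> fixes the V-component of
      \<open>h\<close>.\<close>
    have "snd (h x) = v" if "x \<in> carrier X - U k" for x
      using k(2) that v by (auto simp: fun_space_le C_def A_order_le)
    with k(1) show ?thesis by blast
  qed
  \<comment> \<open>Both instances of \<open>step\<close> use the same \<open>h\<close>. A point
    outside \<open>U k\<close> and outside \<open>U l\<close> would give \<open>h\<close> the
    V-components \<open>VLeft\<close> and \<open>VRight\<close> at once, so a bound \<open>m\<close>
    of \<open>k\<close> and \<open>l\<close> has no empty set component.\<close>
  obtain h0 where h0: "h0 \<in> H" "\<And>x. x \<in> carrier X \<Longrightarrow> G h0 x \<noteq> {}"
  proof -
    obtain h where h: "h \<in> H" using directed_inD(2)[OF H(1)] by blast
    obtain k where k: "k \<in> H" "\<forall>x\<in>carrier X - U k. snd (h x) = VLeft" using step[OF h, of VLeft] by blast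
    obtain l where l: "l \<in> H" "\<forall>x\<in>carrier X - U l. snd (h x) = VRight" using step[OF h, of VRight] by blast
    obtain m where m: "m \<in> H" "k \<sqsubseteq>\<^bsub>?F\<^esub> m" "l \<sqsubseteq>\<^bsub>?F\<^esub> m" using directed_inD(3)[OF H(1) k(1) l(1)] by blast
    have "G m x \<noteq> {}" if x: "x \<in> carrier X" for x
    proof
      assume "G m x = {}"
      then have "x \<in> carrier X - U k" "x \<in> carrier X - U l"
        using G_mono[OF m(2) x] G_mono[OF m(3) x] x unfolding U_def by auto
      then show False using k(2) l(2) by force
    qed
    with m(1) that show thesis by blast
  qed
  \<comment> \<open>Passing to the members above \<open>h0\<close> keeps a cofinal part of
    \<open>H\<close> and makes every \<open>G h x\<close> nonempty, hence directed.\<close>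
  define H' where "H' = {h \<in> H. h0 \<sqsubseteq>\<^bsub>?F\<^esub> h}"
  have H'D: "h \<in> H" "h0 \<sqsubseteq>\<^bsub>?F\<^esub> h" if "h \<in> H'" for h using that unfolding H'_def by auto
  \<comment> \<open>The greatest element of \<open>G h x\<close>, which exists because this set is
    finite and directed. The restriction makes \<open>d h\<close> extensional.\<close>
  define d where "d h = (\<lambda>x\<in>carrier X. SOME m. m \<in> G h x \<and> (\<forall>y\<in>G h x. y \<sqsubseteq>\<^bsub>X\<^esub> m))" for h
  have d: "d h x \<in> G h x" "\<And>y. y \<in> G h x \<Longrightarrow> y \<sqsubseteq>\<^bsub>X\<^esub> d h x"
    if h: "h \<in> H'" and x: "x \<in> carrier X" for h x
  proof -
    have "G h x \<noteq> {}" using h0(2)[OF x] G_mono[OF H'D(2)[OF h] x] by blast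
    then have dir: "directed_in X (G h x)" using G_dir[OF H'D(1)[OF h] x] by blast
    have "finite (G h x)" using G_finite[OF H'D(1)[OF h]] x finite_subset by blast
    from directed_in_finite_bound[OF poX dir this subset_refl]
    have "\<exists>m. m \<in> G h x \<and> (\<forall>y\<in>G h x. y \<sqsubseteq>\<^bsub>X\<^esub> m)" by blast
    from someI_ex[OF this]
    have m: "d h x \<in> G h x \<and> (\<forall>y\<in>G h x. y \<sqsubseteq>\<^bsub>X\<^esub> d h x)" using x by (simp add: d_def)
    show "d h x \<in> G h x" "\<And>y. y \<in> G h x \<Longrightarrow> y \<sqsubseteq>\<^bsub>X\<^esub> d h x" using m by blast+
  qed
  have G_W: "G h x \<subseteq> W x" if "h \<in> H" "x \<in> carrier X" for h x
    using G_sup[OF that(2)] that(1) by blast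
  have d_wb: "way_below X (d h x) x" if "h \<in> H'" "x \<in> carrier X" for h x
    using d(1)[OF that] G_W[OF H'D(1)[OF that(1)] that(2)] unfolding W_def by blast
  have d_c: "d h x \<in> carrier X" if "h \<in> H'" "x \<in> carrier X" for h x
    using way_below_carrier[OF d_wb[OF that]] by blast
  have d_le: "d h x \<sqsubseteq>\<^bsub>X\<^esub> x" if "h \<in> H'" "x \<in> carrier X" for h x
    by (rule way_below_le[OF poX d_wb[OF that]])
  have d_defl: "deflation X (d h)" if h: "h \<in> H'" for h
    unfolding deflation_def
  proof (intro conjI ballI)
    have "restrict (d h) (carrier X) \<in> carrier (fun_space X X)"
    proof (rule fun_space_carrierI[OF poX poX d_c[OF h]])
      show "d h x \<sqsubseteq>\<^bsub>X\<^esub> d h y" if "x \<in> carrier X" "y \<in> carrier X" "x \<sqsubseteq>\<^bsub>X\<^esub> y" for x y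
        using d(2)[OF h that(2)] d(1)[OF h that(1)] G_incr[OF H'D(1)[OF h] that] by blast
      fix D s u assume D: "directed_in X D" "is_lub X s D" and s: "s \<in> carrier X" and u: "u \<in> carrier X"
        and le: "\<And>x. x \<in> D \<Longrightarrow> d h x \<sqsubseteq>\<^bsub>X\<^esub> u"
      \<comment> \<open>\<open>G h s\<close> is the union of the sets \<open>G h x\<close> with
        \<open>x\<close> in \<open>D\<close>, so the maximum at \<open>s\<close> already occurs in
        one of them and lies below the maximum there.\<close>
      obtain x where x: "x \<in> D" "d h s \<in> G h x"
        using d(1)[OF h s] G_lub[OF H'D(1)[OF h] D] by blast
      then have xX: "x \<in> carrier X" using directed_inD(1)[OF D(1)] by blast
      show "d h s \<sqsubseteq>\<^bsub>X\<^esub> u"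
        by (rule po_trans[OF poX d(2)[OF h xX x(2)] le[OF x(1)] d_c[OF h s] d_c[OF h xX] u])
    qed auto
    moreover have "restrict (d h) (carrier X) = d h" by (simp add: d_def)
    ultimately show "d h \<in> carrier (fun_space X X)" by simp
    obtain S where S: "finite S" "\<forall>x\<in>carrier X. G h x \<subseteq> S" using G_finite[OF H'D(1)[OF h]] by blast
    then have "d h ` carrier X \<subseteq> S" using d(1)[OF h] by blast
    then show "finite (d h ` carrier X)" using S(1) by (rule finite_subset)
  qed (rule d_le[OF h])
  let ?D = "d ` H'"
  have cofinal: "\<exists>k\<in>H'. h \<sqsubseteq>\<^bsub>?F\<^esub> k" if h: "h \<in> H" for h
    using directed_inD(3)[OF H(1) h h0(1)] unfolding H'_def by blast
  have H'_dir: "directed_in ?F H'"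
  proof (rule directed_inI)
    show "H' \<subseteq> carrier ?F" using H'D(1) Hc by blast
    show "H' \<noteq> {}" using cofinal[OF h0(1)] by blast
    fix h k assume hk: "h \<in> H'" "k \<in> H'"
    obtain l where l: "l \<in> H" "h \<sqsubseteq>\<^bsub>?F\<^esub> l" "k \<sqsubseteq>\<^bsub>?F\<^esub> l"
      using directed_inD(3)[OF H(1) H'D(1)[OF hk(1)] H'D(1)[OF hk(2)]] by blast
    have "h0 \<sqsubseteq>\<^bsub>?F\<^esub> l"
      by (rule po_trans[OF poF H'D(2)[OF hk(1)] l(2) Hc[OF h0(1)] Hc[OF H'D(1)[OF hk(1)]] Hc[OF l(1)]])
    then show "\<exists>z\<in>H'. h \<sqsubseteq>\<^bsub>?F\<^esub> z \<and> k \<sqsubseteq>\<^bsub>?F\<^esub> z" using l unfolding H'_def by blast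
  qed
  have D_dir: "directed_in (fun_space X X) ?D"
  proof (rule directed_in_image[OF H'_dir deflationD(1)[OF d_defl]])
    fix h k assume hk: "h \<in> H'" "k \<in> H'" "h \<sqsubseteq>\<^bsub>?F\<^esub> k"
    show "d h \<sqsubseteq>\<^bsub>fun_space X X\<^esub> d k"
      unfolding fun_space_le
    proof
      fix x assume x: "x \<in> carrier X"
      show "d h x \<sqsubseteq>\<^bsub>X\<^esub> d k x" using d(2)[OF hk(2) x] d(1)[OF hk(1) x] G_mono[OF hk(3) x] by blast
    qed
  qed
  have "is_lub (fun_space X X) (restrict id (carrier X)) ?D"
  proof (rule is_lubI[OF directed_inD(1)[OF D_dir]])
    show "restrict id (carrier X) \<in> carrier (fun_space X X)"
    proof (rule fun_space_carrierI[OF poX poX])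
      show "id s \<sqsubseteq>\<^bsub>X\<^esub> u" if "directed_in X D" "is_lub X s D" "u \<in> carrier X"
        "\<And>d. d \<in> D \<Longrightarrow> id d \<sqsubseteq>\<^bsub>X\<^esub> u" for D s u
        using is_lub_least[OF that(2) directed_inD(1)[OF that(1)] that(3)] that(4) by simp
    qed auto
    show "e \<sqsubseteq>\<^bsub>fun_space X X\<^esub> restrict id (carrier X)" if "e \<in> ?D" for e
      using that d_le by (auto simp: fun_space_le)
    fix u assume u: "u \<in> carrier (fun_space X X)" "\<And>e. e \<in> ?D \<Longrightarrow> e \<sqsubseteq>\<^bsub>fun_space X X\<^esub> u"
    have "x \<sqsubseteq>\<^bsub>X\<^esub> u x" if x: "x \<in> carrier X" for x
    proof (rule is_lub_least[OF W(2)[OF x] directed_inD(1)[OF W(1)[OF x]]])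
      show ux: "u x \<in> carrier X" by (rule fun_spaceD(3)[OF u(1) x])
      fix y assume y: "y \<in> W x"
      \<comment> \<open>An element \<open>y\<close> way below \<open>x\<close> is caught by some
        \<open>G h x\<close>; cofinality replaces \<open>h\<close> by a member of \<open>H'\<close>,
        whose deflation at \<open>x\<close> dominates \<open>y\<close>.\<close>
      then obtain h where h: "h \<in> H" "y \<in> G h x" using G_sup[OF x] by blast
      then obtain k where k: "k \<in> H'" "h \<sqsubseteq>\<^bsub>?F\<^esub> k" using cofinal by blast
      then have "y \<sqsubseteq>\<^bsub>X\<^esub> d k x" using d(2)[OF k(1) x] G_mono[OF k(2) x] h(2) by blast
      moreover have "d k x \<sqsubseteq>\<^bsub>X\<^esub> u x" using u(2)[of "d k"] k(1) x by (simp add: fun_space_le)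
      ultimately show "y \<sqsubseteq>\<^bsub>X\<^esub> u x"
        using po_trans[OF poX, of y "d k x" "u x"] directed_inD(1)[OF W(1)[OF x]] y d_c[OF k(1) x] ux
        by blast
    qed
    then show "restrict id (carrier X) \<sqsubseteq>\<^bsub>fun_space X X\<^esub> u" by (simp add: fun_space_le)
  qed
  moreover have "\<forall>e\<in>?D. deflation X e" using d_defl by blast
  ultimately show ?thesis using X D_dir unfolding RB_domain_def by blast
qed

section \<open>Transport along order isomorphisms\<close>

text \<open>A quantifier over domains ranges over orders on one fixed type. Isomorphisms serve to
  move the test domain into such a type and to carry continuity of function spaces back.\<close>

definition order_iso :: "('a \<Rightarrow> 'b) \<Rightarrow> 'a gorder \<Rightarrow> 'b gorder \<Rightarrow> bool" where
  "order_iso \<phi> L M \<longleftrightarrow> partial_order L \<and> partial_order M \<and> bij_betw \<phi> (carrier L) (carrier M) \<and>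
    (\<forall>x\<in>carrier L. \<forall>y\<in>carrier L. \<phi> x \<sqsubseteq>\<^bsub>M\<^esub> \<phi> y \<longleftrightarrow> x \<sqsubseteq>\<^bsub>L\<^esub> y)"

lemma order_isoD:
  assumes "order_iso \<phi> L M"
  shows "partial_order L" "partial_order M" "\<phi> ` carrier L = carrier M" "inj_on \<phi> (carrier L)"
    "x \<in> carrier L \<Longrightarrow> \<phi> x \<in> carrier M"
    "\<lbrakk>x \<in> carrier L; y \<in> carrier L\<rbrakk> \<Longrightarrow> \<phi> x \<sqsubseteq>\<^bsub>M\<^esub> \<phi> y \<longleftrightarrow> x \<sqsubseteq>\<^bsub>L\<^esub> y"
  using assms unfolding order_iso_def bij_betw_def by auto

lemma order_iso_inv:
  assumes "order_iso \<phi> L M"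
  shows "order_iso (inv_into (carrier L) \<phi>) M L"
proof -
  note I = order_isoD[OF assms]
  have bij: "bij_betw \<phi> (carrier L) (carrier M)" using assms by (simp add: order_iso_def)
  have "inv_into (carrier L) \<phi> x \<sqsubseteq>\<^bsub>L\<^esub> inv_into (carrier L) \<phi> y \<longleftrightarrow> x \<sqsubseteq>\<^bsub>M\<^esub> y"
    if "x \<in> carrier M" "y \<in> carrier M" for x y
    using I(6)[of "inv_into (carrier L) \<phi> x" "inv_into (carrier L) \<phi> y"] that I(3)
    by (simp add: inv_into_into f_inv_into_f)
  then show ?thesis using I(1,2) bij_betw_inv_into[OF bij] unfolding order_iso_def by blast
qed

lemma order_iso_directed:
  assumes "order_iso \<phi> L M" "directed_in L D"
  shows "directed_in M (\<phi> ` D)"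
proof (rule directed_in_image[OF assms(2)])
  show "\<phi> x \<in> carrier M" if "x \<in> D" for x
    using order_isoD(5)[OF assms(1)] directed_inD(1)[OF assms(2)] that by blast
  show "\<phi> x \<sqsubseteq>\<^bsub>M\<^esub> \<phi> y" if "x \<in> D" "y \<in> D" "x \<sqsubseteq>\<^bsub>L\<^esub> y" for x y
    using order_isoD(6)[OF assms(1), of x y] directed_inD(1)[OF assms(2)] that by blast
qed

lemma order_iso_lub:
  assumes iso: "order_iso \<phi> L M" and D: "D \<subseteq> carrier L" and lub: "is_lub L s D"
  shows "is_lub M (\<phi> s) (\<phi> ` D)"
proof (rule is_lubI)
  note I = order_isoD[OF iso]
  have s: "s \<in> carrier L" using lub by (rule is_lub_carrier)
  show "\<phi> ` D \<subseteq> carrier M" using I(5) D by blast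
  show "\<phi> s \<in> carrier M" by (rule I(5)[OF s])
  show "y \<sqsubseteq>\<^bsub>M\<^esub> \<phi> s" if "y \<in> \<phi> ` D" for y
    using that I(6)[OF _ s] is_lub_upper[OF lub D] D by blast
  fix u assume u: "u \<in> carrier M" "\<And>y. y \<in> \<phi> ` D \<Longrightarrow> y \<sqsubseteq>\<^bsub>M\<^esub> u"
  then obtain v where v: "v \<in> carrier L" "u = \<phi> v" using I(3) by blast
  have "x \<sqsubseteq>\<^bsub>L\<^esub> v" if "x \<in> D" for x using u(2)[of "\<phi> x"] that I(6)[of x v] v D by blast
  then have "s \<sqsubseteq>\<^bsub>L\<^esub> v" using is_lub_least[OF lub D v(1)] by blast
  then show "\<phi> s \<sqsubseteq>\<^bsub>M\<^esub> u" using I(6)[OF s v(1)] v(2) by simp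
qed

lemma order_iso_dcpo:
  assumes iso: "order_iso \<phi> L M" and L: "dcpo L"
  shows "dcpo M"
  unfolding dcpo_def
proof (intro conjI allI impI)
  let ?\<psi> = "inv_into (carrier L) \<phi>"
  show "partial_order M" by (rule order_isoD(2)[OF iso])
  fix D assume D: "directed_in M D"
  note D' = order_iso_directed[OF order_iso_inv[OF iso] D]
  obtain s where "is_lub L s (?\<psi> ` D)" using dcpo_lub[OF L D'] by blast
  from order_iso_lub[OF iso directed_inD(1)[OF D'] this]
  have "is_lub M (\<phi> s) (\<phi> ` ?\<psi> ` D)" .
  moreover have "\<phi> ` ?\<psi> ` D = D"
    using directed_inD(1)[OF D] order_isoD(3)[OF iso] by (intro image_inv_into_cancel) auto
  ultimately show "\<exists>s. is_lub M s D" by auto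
qed

text \<open>A directed set in \<open>M\<close> is pulled back along the inverse isomorphism, where
  the relation in \<open>L\<close> applies, and the witness is pushed forward again.\<close>

lemma order_iso_way_below:
  assumes iso: "order_iso \<phi> L M" and wb: "way_below L x y"
  shows "way_below M (\<phi> x) (\<phi> y)"
proof (rule way_belowI)
  note I = order_isoD[OF iso]
  let ?\<psi> = "inv_into (carrier L) \<phi>"
  note iso' = order_iso_inv[OF iso]
  have xy: "x \<in> carrier L" "y \<in> carrier L" using way_below_carrier[OF wb] by blast+
  then show "\<phi> x \<in> carrier M" "\<phi> y \<in> carrier M" by (simp_all add: I(5))
  fix D s assume D: "directed_in M D" "is_lub M s D" and le: "\<phi> y \<sqsubseteq>\<^bsub>M\<^esub> s"
  have "?\<psi> (\<phi> y) \<sqsubseteq>\<^bsub>L\<^esub> ?\<psi> s"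
    using order_isoD(6)[OF iso' I(5)[OF xy(2)] is_lub_carrier[OF D(2)]] le by blast
  then have "y \<sqsubseteq>\<^bsub>L\<^esub> ?\<psi> s" using I(4) xy(2) by simp
  then obtain d where d: "d \<in> D" "x \<sqsubseteq>\<^bsub>L\<^esub> ?\<psi> d"
    using way_belowD[OF wb order_iso_directed[OF iso' D(1)]
        order_iso_lub[OF iso' directed_inD(1)[OF D(1)] D(2)]] by blast
  have dM: "d \<in> carrier M" using d(1) directed_inD(1)[OF D(1)] by blast
  then have "\<phi> x \<sqsubseteq>\<^bsub>M\<^esub> \<phi> (?\<psi> d)"
    using I(6)[OF xy(1) order_isoD(5)[OF iso' dM]] d(2) by blast
  moreover have "\<phi> (?\<psi> d) = d" using dM I(3) by (simp add: f_inv_into_f)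
  ultimately show "\<exists>d\<in>D. \<phi> x \<sqsubseteq>\<^bsub>M\<^esub> d" using d(1) by auto
qed

lemma order_iso_continuous_dcpo:
  assumes iso: "order_iso \<phi> L M" and L: "continuous_dcpo L"
  shows "continuous_dcpo M"
proof (rule continuous_dcpoI)
  show "dcpo M" by (rule order_iso_dcpo[OF iso continuous_dcpoD(1)[OF L]])
  fix y assume "y \<in> carrier M"
  then obtain x where x: "x \<in> carrier L" "y = \<phi> x" using order_isoD(3)[OF iso] by blast
  let ?B = "{z. way_below L z x}"
  note B = continuous_dcpoD(2,3)[OF L x(1)]
  have "directed_in M (\<phi> ` ?B)" by (rule order_iso_directed[OF iso B(1)])
  moreover have "is_lub M y (\<phi> ` ?B)"
    unfolding x(2) by (rule order_iso_lub[OF iso directed_inD(1)[OF B(1)] B(2)])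
  moreover have "\<forall>b\<in>\<phi> ` ?B. way_below M b y" using order_iso_way_below[OF iso] x(2) by blast
  ultimately show "\<exists>B. directed_in M B \<and> is_lub M y B \<and> (\<forall>b\<in>B. way_below M b y)" by blast
qed

section \<open>Function spaces with isomorphic targets and copies of the test domain\<close>

lemma order_iso_compose_fun_space:
  assumes X: "partial_order X" and iso: "order_iso \<phi> Y Z" and f: "f \<in> carrier (fun_space X Y)"
  shows "(\<lambda>x\<in>carrier X. \<phi> (f x)) \<in> carrier (fun_space X Z)"
proof (rule fun_space_carrierI[OF X order_isoD(2)[OF iso]])
  note I = order_isoD[OF iso]
  note fS = fun_spaceD(1)[OF f]
  show "\<phi> (f x) \<in> carrier Z" if "x \<in> carrier X" for x
    by (rule I(5)[OF fun_spaceD(3)[OF f that]])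
  show "\<phi> (f x) \<sqsubseteq>\<^bsub>Z\<^esub> \<phi> (f y)" if "x \<in> carrier X" "y \<in> carrier X" "x \<sqsubseteq>\<^bsub>X\<^esub> y" for x y
    using I(6)[OF fun_spaceD(3)[OF f that(1)] fun_spaceD(3)[OF f that(2)]]
      scott_continuousD(2)[OF fS that] by blast
  fix D s u assume D: "directed_in X D" "is_lub X s D" and u: "u \<in> carrier Z"
    and le: "\<And>d. d \<in> D \<Longrightarrow> \<phi> (f d) \<sqsubseteq>\<^bsub>Z\<^esub> u"
  note fD = directed_inD(1)[OF scott_continuous_directed_image[OF fS D(1)]]
  have sub: "\<phi> ` f ` D \<subseteq> carrier Z" using fD I(5) by blast
  show "\<phi> (f s) \<sqsubseteq>\<^bsub>Z\<^esub> u"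
    by (rule is_lub_least[OF order_iso_lub[OF iso fD scott_continuousD(3)[OF fS D]] sub u])
      (use le in blast)
qed

text \<open>Postcomposition with the inverse of \<phi> inverts postcomposition with \<phi>; the
  restrictions keep both within extensional maps.\<close>

lemma order_iso_fun_space:
  assumes X: "partial_order X" and iso: "order_iso \<phi> Y Z"
  shows "order_iso (\<lambda>f. \<lambda>x\<in>carrier X. \<phi> (f x)) (fun_space X Y) (fun_space X Z)"
proof -
  note I = order_isoD[OF iso]
  let ?\<psi> = "inv_into (carrier Y) \<phi>"
  let ?\<Phi> = "\<lambda>f. \<lambda>x\<in>carrier X. \<phi> (f x)" and ?\<Psi> = "\<lambda>g. \<lambda>x\<in>carrier X. ?\<psi> (g x)"
  have "bij_betw ?\<Phi> (carrier (fun_space X Y)) (carrier (fun_space X Z))"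
  proof (rule bij_betw_byWitness[where f' = ?\<Psi>])
    show "\<forall>f\<in>carrier (fun_space X Y). ?\<Psi> (?\<Phi> f) = f"
    proof
      fix f assume f: "f \<in> carrier (fun_space X Y)"
      show "?\<Psi> (?\<Phi> f) = f"
      proof (rule extensionalityI[OF restrict_extensional fun_spaceD(2)[OF f]])
        show "?\<Psi> (?\<Phi> f) x = f x" if "x \<in> carrier X" for x
          using that fun_spaceD(3)[OF f that] I(4) by simp
      qed
    qed
    show "\<forall>g\<in>carrier (fun_space X Z). ?\<Phi> (?\<Psi> g) = g"
    proof
      fix g assume g: "g \<in> carrier (fun_space X Z)"
      show "?\<Phi> (?\<Psi> g) = g"
      proof (rule extensionalityI[OF restrict_extensional fun_spaceD(2)[OF g]])
        show "?\<Phi> (?\<Psi> g) x = g x" if "x \<in> carrier X" for x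
          using that fun_spaceD(3)[OF g that] I(3) by (simp add: f_inv_into_f)
      qed
    qed
    show "?\<Phi> ` carrier (fun_space X Y) \<subseteq> carrier (fun_space X Z)"
      using order_iso_compose_fun_space[OF X iso] by (rule image_subsetI)
    show "?\<Psi> ` carrier (fun_space X Z) \<subseteq> carrier (fun_space X Y)"
      using order_iso_compose_fun_space[OF X order_iso_inv[OF iso]] by (rule image_subsetI)
  qed
  moreover have "?\<Phi> f \<sqsubseteq>\<^bsub>fun_space X Z\<^esub> ?\<Phi> g \<longleftrightarrow> f \<sqsubseteq>\<^bsub>fun_space X Y\<^esub> g"
    if "f \<in> carrier (fun_space X Y)" "g \<in> carrier (fun_space X Y)" for f g
    using I(6)[OF fun_spaceD(3)[OF that(1)] fun_spaceD(3)[OF that(2)]] by (simp add: fun_space_le)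
  ultimately show ?thesis
    using fun_space_po[OF I(1)] fun_space_po[OF I(2)] unfolding order_iso_def by blast
qed

text \<open>A copy of \<open>L\<close> inside another type, with the order read off through the
  inverse of \<phi>. It is used for \<phi> injective on the carrier.\<close>

definition image_order :: "('a \<Rightarrow> 'b) \<Rightarrow> 'a gorder \<Rightarrow> 'b gorder" where
  "image_order \<phi> L = \<lparr>carrier = \<phi> ` carrier L, eq = (=),
     le = (\<lambda>x y. inv_into (carrier L) \<phi> x \<sqsubseteq>\<^bsub>L\<^esub> inv_into (carrier L) \<phi> y)\<rparr>"

lemma order_iso_image_order:
  assumes L: "partial_order L" and inj: "inj_on \<phi> (carrier L)"
  shows "order_iso \<phi> L (image_order \<phi> L)"
proof -
  let ?M = "image_order \<phi> L"
  have car: "carrier ?M = \<phi> ` carrier L" by (simp add: image_order_def)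
  have le: "\<phi> x \<sqsubseteq>\<^bsub>?M\<^esub> \<phi> y \<longleftrightarrow> x \<sqsubseteq>\<^bsub>L\<^esub> y" if "x \<in> carrier L" "y \<in> carrier L" for x y
    using that inj by (simp add: image_order_def)
  have "partial_order ?M"
  proof (rule partial_orderI)
    fix x y z assume "x \<sqsubseteq>\<^bsub>?M\<^esub> y" "y \<sqsubseteq>\<^bsub>?M\<^esub> z" "x \<in> carrier ?M" "y \<in> carrier ?M" "z \<in> carrier ?M"
    then show "x \<sqsubseteq>\<^bsub>?M\<^esub> z" using le po_trans[OF L] unfolding car by (auto 0 3)
  next
    fix x y assume "x \<sqsubseteq>\<^bsub>?M\<^esub> y" "y \<sqsubseteq>\<^bsub>?M\<^esub> x" "x \<in> carrier ?M" "y \<in> carrier ?M"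
    then show "x = y" using le po_antisym[OF L] unfolding car by blast
  next
    fix x assume "x \<in> carrier ?M"
    then show "x \<sqsubseteq>\<^bsub>?M\<^esub> x" using le po_refl[OF L] unfolding car by auto
  qed (simp add: image_order_def)
  then show ?thesis using L le inj car unfolding order_iso_def bij_betw_def by blast
qed

text \<open>The copy of A_X along \<iota> is a domain on type \<open>'e\<close>, so
  \<open>cont\<close> applies to it. The inverse isomorphism, lifted to function spaces, returns
  continuity to the maps from \<open>X\<close> into A_X itself.\<close>

lemma RB_domainI_transported_test_domain:
  fixes X :: "'a gorder" and \<iota> :: "('a set \<times> nat) \<times> vee \<Rightarrow> 'e"
  assumes X: "cont_domain X" and inj: "inj_on \<iota> (carrier (A_order X))"
    and cont: "\<And>E :: 'e gorder. cont_domain E \<Longrightarrow> continuous_dcpo (fun_space X E)"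
  shows "RB_domain X"
proof (rule fun_space_continuous_imp_RB_domain[OF X])
  have poX: "partial_order X" using X dcpo_po unfolding cont_domain_def continuous_dcpo_def by blast
  note A = A_order_cont_domain[OF poX]
  have "partial_order (A_order X)" using A dcpo_po unfolding cont_domain_def continuous_dcpo_def by blast
  note iso = order_iso_image_order[OF this inj]
  have "continuous_dcpo (image_order \<iota> (A_order X))"
    using A order_iso_continuous_dcpo[OF iso] unfolding cont_domain_def by blast
  then have "cont_domain (image_order \<iota> (A_order X))"
    using A order_isoD(3)[OF iso] unfolding cont_domain_def by blast
  then show "continuous_dcpo (fun_space X (A_order X))"
    by (rule order_iso_continuous_dcpo[OF order_iso_fun_space[OF poX order_iso_inv[OF iso]] cont])
qed

text \<open>Since \<open>E\<close> ranges over orders on one type \<open>'e\<close>, the converse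
  direction assumes that \<open>'e\<close> has room for A_X, expressed by the injection \<iota>.
  Instantiating \<open>'e\<close> with the element type of \<open>A_order X\<close> and \<iota> with
  the identity satisfies this.\<close>

theorem theorem3p9:
  fixes X :: "'a gorder"
  assumes "cont_domain X"
  shows "(RB_domain X \<longrightarrow>
           (\<forall>E :: 'e gorder. cont_domain E \<longrightarrow> continuous_dcpo (fun_space X E)))
       \<and> ((\<exists>\<iota> :: ('a set \<times> nat) \<times> vee \<Rightarrow> 'e. inj_on \<iota> (carrier (A_order X))) \<longrightarrow>
           (RB_domain X \<longleftrightarrow>
             (\<forall>E :: 'e gorder. cont_domain E \<longrightarrow> continuous_dcpo (fun_space X E))))
       \<and> cont_domain (A_order X) \<and> algebraic_dcpo (A_order X)
       \<and> (continuous_dcpo (fun_space X (A_order X)) \<longrightarrow> RB_domain X)"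
proof -
  have poX: "partial_order X"
    using assms dcpo_po unfolding cont_domain_def continuous_dcpo_def by blast
  have RB: "continuous_dcpo (fun_space X E)" if "RB_domain X" "cont_domain E" for E :: "'e gorder"
    using RB_domain_imp_fun_space_continuous[OF that(1)] that(2) unfolding cont_domain_def by blast
  show ?thesis
    by (intro conjI impI iffI allI; (elim exE)?)
      (simp_all add: RB A_order_cont_domain[OF poX] A_order_algebraic[OF poX]
        fun_space_continuous_imp_RB_domain[OF assms] RB_domainI_transported_test_domain[OF assms])
qed

end
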